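(* Let $a\in\mathbb{R}^{d\times(n+1)}$ with $f_i^L=a_{i0}<\cdots<a_{in}=f_i^U$ for each $i$, and let $\mathcal{H}=\{\prod_{i=1}^d[a_{i,t_i-1},a_{it_i}]\mid t\in\{1,\dots,n\}^d\}$. Let $\theta=(\theta_1,\dots,\theta_\kappa):\mathbb{R}^d\to\mathbb{R}^\kappa$ and assume that for every $k\in\{1,\dots,\kappa\}$, $\theta_k$ is supermodular over $[f^L,f^U]$ and the function $s\mapsto\theta_k(s_{1n},\dots,s_{dn})$ on $Q$ is concave-extendable from $\mathrm{vert}(Q)$. Then an ideal MILP formulation of $\bigcup_{H\in\mathcal{H}}\mathrm{conv}\bigl(\mathrm{hyp}(\theta|_H)\bigr)$ (in the variables $(f,\theta)$) is given by $$\Bigl\{(f,\theta,\lambda,\delta)\Bigm|\theta_k\le\mathrm{conc}_\Lambda(\theta_k\circ A)(\lambda),\ k=1,\dots,\kappa,\ f=A(\lambda),\ (\lambda_i,\delta_i)\in(\mathrm{LOG}_i),\ i=1,\dots,d\Bigr\},$$ where for each $k$ and $\lambda\in\Lambda$ $$\mathrm{conc}_\Lambda(\theta_k\circ A)(\lambda)=\min_{\omega\in\Omega}\Bigl\{\theta_k\bigl(\Pi(a;p^0)\bigr)+\sum_{i=1}^d\sum_{t:\omega_t=i}\bigl[\theta_k(\Pi(a;p^t))-\theta_k(\Pi(a;p^{t-1}))\bigr](\lambda_{ip^t_i}+\cdots+\lambda_{in})\Bigr\}.$$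
   Context: Supermodular over $[f^L,f^U]=\prod_i[f_i^L,f_i^U]$: $g(x'\vee x'')+g(x'\wedge x'')\ge g(x')+g(x'')$ (componentwise max/min). $Q=\prod_iQ_i$, $Q_i$ the simplex with vertices $v_{ij}=(a_{i0},\dots,a_{i,j-1},a_{ij},\dots,a_{ij})\in\mathbb{R}^{n+1}$, $j=0,\dots,n$; points of $Q$ are $s=(s_{ij})$. A function $g$ on a polytope $S$ is concave-extendable from $Y\subseteq S$ if the concave envelope of $g$ over $S$ equals that of $g$ restricted to $Y$ (set to $-\infty$ off $Y$). $\mathrm{conc}_\Lambda$ denotes concave envelope over $\Lambda$. $\Omega$: set of direction vectors $\omega\in\{1,\dots,d\}^{dn}$ in which each $i$ occurs exactly $n$ times; $\omega$ defines $p^0=0$, $p^t=p^{t-1}+e_{\omega_t}$, $t=1,\dots,dn$. $\Pi(a;p)=(a_{1p_1},\dots,a_{dp_d})$ for $p\in\{0,\dots,n\}^d$. $\Lambda=\prod_{i=1}^d\Lambda_i$, $\Lambda_i=\{\lambda_i=(\lambda_{i0},\dots,\lambda_{in})\ge0\mid\sum_{j=0}^n\lambda_{ij}=1\}$; $A(\lambda)=(A_1(\lambda_1),\dots,A_d(\lambda_d))$, $A_i(\lambda_i)=\sum_{j=0}^na_{ij}\lambda_{ij}$. $(\mathrm{LOG}_i)$: fix distinct $\eta^{(1)},\dots,\eta^{(n)}\in\{0,1\}^{\lceil\log_2n\rceil}$ such that $\eta^{(t)},\eta^{(t+1)}$ differ in at most one component, $\eta^{(0)}=\eta^{(1)}$,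 $\eta^{(n+1)}=\eta^{(n)}$. Let $L_{ik}=\{j\in\{0,\dots,n\}\mid\eta^{(j)}_k=1\text{ or }\eta^{(j+1)}_k=1\}$, $R_{ik}=\{j\in\{0,\dots,n\}\mid\eta^{(j)}_k=0\text{ or }\eta^{(j+1)}_k=0\}$. $(\lambda_i,\delta_i)\in(\mathrm{LOG}_i)$ means $\lambda_i\in\Lambda_i$, $\delta_i\in\{0,1\}^{\lceil\log_2n\rceil}$ and $\sum_{j\notin L_{ik}}\lambda_{ij}\le\delta_{ik}\le1-\sum_{j\notin R_{ik}}\lambda_{ij}$ for all $k$. $\mathrm{hyp}(\theta|_H)=\{(f,\mu)\mid\mu\le\theta(f)\text{ componentwise},\ f\in H\}$. For $S\subseteq\mathbb{R}^{n_1}$, $E=R\cap(\mathbb{R}^{n_1}\times\mathbb{R}^{n_2}\times\{0,1\}^{n_3})$ is an MIP formulation of $S$ if $S=\mathrm{proj}_x(E)$; $R$ is its continuous relaxation (here $\delta_{ik}\in[0,1]$). It is MILP if $R$ is a polyhedron, and ideal if $\mathrm{proj}_\delta(\mathrm{vert}(R))\subseteq\{0,1\}^{n_3}$, where $\mathrm{vert}$ denotes extreme points. *)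

theory Defs
  imports "HOL-Analysis.Analysis"
begin

text \<open>
  The dimensions \<open>d\<close>, \<open>\<kappa>\<close>, \<open>n\<close> are \<open>CARD('d)\<close>, \<open>CARD('k)\<close>, \<open>CARD('n)\<close>.
  Entries \<open>a\<^sub>i\<^sub>j\<close> are written \<open>a i j\<close> and only matter for \<open>j \<in> {0..n}\<close>.
\<close>

definition nbits :: "nat \<Rightarrow> nat" where
  "nbits n = nat \<lceil>log 2 (real n)\<rceil>"

text \<open>The index set \<open>{0..n}\<close> as a type, so that \<open>real ^ 'n node\<close> is \<open>\<real>\<^sup>n\<^sup>+\<^sup>1\<close>.\<close>

typedef ('n::finite) node = "{0..CARD('n)}"
  by auto

instance node :: (finite) finite
proof
  have "(UNIV :: 'a node set) = Abs_node ` {0..CARD('a)}"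
    by (rule type_definition.Abs_image[OF type_definition_node, symmetric])
  then show "finite (UNIV :: 'a node set)"
    by (metis finite_atLeastAtMost finite_imageI)
qed

abbreviation node_nth :: "real ^ 'n::finite node \<Rightarrow> nat \<Rightarrow> real" (infixl "$n" 90) where
  "x $n j \<equiv> x $ Abs_node j"

text \<open>
  Index set of the vector \<open>(\<lambda>\<^sub>i, \<delta>\<^sub>i)\<close>.  A separate type for \<open>\<delta>\<^sub>i\<close> is impossible,
  since \<open>\<delta>\<^sub>i\<close> has no components at all if \<open>n = 1\<close>.
\<close>

typedef ('n::finite) logcoord = "{0..CARD('n)} <+> {1..nbits (CARD('n))}"
  by (auto intro!: exI[of _ "Inl 0"])

instance logcoord :: (finite) finite
proof
  have "(UNIV :: 'a logcoord set) = Abs_logcoord ` ({0..CARD('a)} <+> {1..nbits (CARD('a))})"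
    by (rule type_definition.Abs_image[OF type_definition_logcoord, symmetric])
  then show "finite (UNIV :: 'a logcoord set)"
    by (metis finite_Plus finite_atLeastAtMost finite_imageI)
qed

definition lam_part :: "real ^ 'n::finite logcoord \<Rightarrow> real ^ 'n node" where
  "lam_part z = (\<chi> j. z $ Abs_logcoord (Inl (Rep_node j)))"

definition delta_part :: "real ^ 'n::finite logcoord \<Rightarrow> nat \<Rightarrow> real" where
  "delta_part z k = z $ Abs_logcoord (Inr k)"


definition supermodular_on :: "(real ^ 'd::finite) set \<Rightarrow> (real ^ 'd \<Rightarrow> real) \<Rightarrow> bool" where
  "supermodular_on S g \<longleftrightarrow>
     (\<forall>x\<in>S. \<forall>y\<in>S. g (sup x y) + g (inf x y) \<ge> g x + g y)"

text \<open>Concavity by convexity of the hypograph, which avoids the term \<open>\<infinity> - \<infinity>\<close>.\<close>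

definition ereal_concave_on :: "'a::real_vector set \<Rightarrow> ('a \<Rightarrow> ereal) \<Rightarrow> bool" where
  "ereal_concave_on S h \<longleftrightarrow> convex {(x, r::real). x \<in> S \<and> ereal r \<le> h x}"

text \<open>The pointwise least concave overestimator of \<open>g\<close> on \<open>S\<close>.\<close>

definition conc_env :: "'a::real_vector set \<Rightarrow> ('a \<Rightarrow> ereal) \<Rightarrow> 'a \<Rightarrow> ereal" where
  "conc_env S g x = (INF h \<in> {h. ereal_concave_on S h \<and> (\<forall>y\<in>S. g y \<le> h y)}. h x)"

definition concave_extendable ::
    "('a::real_vector \<Rightarrow> real) \<Rightarrow> 'a set \<Rightarrow> 'a set \<Rightarrow> bool" where
  "concave_extendable g S Y \<longleftrightarrow> Y \<subseteq> S \<and>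
     (\<forall>x\<in>S. conc_env S (\<lambda>y. ereal (g y)) x =
             conc_env S (\<lambda>y. if y \<in> Y then ereal (g y) else -\<infinity>) x)"

definition vert :: "'a::real_vector set \<Rightarrow> 'a set" where
  "vert S = {x. x extreme_point_of S}"

definition Q_vertex :: "(nat \<Rightarrow> real) \<Rightarrow> nat \<Rightarrow> real ^ 'n::finite node" where
  "Q_vertex ai j = (\<chi> l. ai (min j (Rep_node l)))"

definition Q_prod :: "('d::finite \<Rightarrow> nat \<Rightarrow> real) \<Rightarrow> (real ^ 'n::finite node ^ 'd) set" where
  "Q_prod a = {s. \<forall>i. s $ i \<in> convex hull (Q_vertex (a i) ` {0..CARD('n)})}"

definition prob_simplex :: "(real ^ 'n::finite node) set" where
  "prob_simplex = {l. (\<forall>j. l $ j \<ge> 0) \<and> (\<Sum>j\<in>{0..CARD('n)}. l $n j) = 1}"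

definition Lambda :: "(real ^ 'n::finite node ^ 'd::finite) set" where
  "Lambda = {l. \<forall>i. l $ i \<in> prob_simplex}"

definition A_map :: "('d::finite \<Rightarrow> nat \<Rightarrow> real) \<Rightarrow> real ^ 'n::finite node ^ 'd \<Rightarrow> real ^ 'd" where
  "A_map a l = (\<chi> i. \<Sum>j\<in>{0..CARD('n)}. a i j * l $ i $n j)"

text \<open>\<open>\<omega>\<close> is a list, so that \<open>\<omega>\<^sub>t\<close> is \<open>\<omega> ! (t - 1)\<close>.\<close>

definition directions :: "nat \<Rightarrow> 'd::finite list set" where
  "directions n = {\<omega>. length \<omega> = CARD('d) * n \<and> (\<forall>i. count_list \<omega> i = n)}"

primrec grid_path :: "'d list \<Rightarrow> nat \<Rightarrow> 'd \<Rightarrow> nat" where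
  "grid_path \<omega> 0 = (\<lambda>i. 0)"
| "grid_path \<omega> (Suc t) = (\<lambda>i. grid_path \<omega> t i + (if i = \<omega> ! t then 1 else 0))"

definition grid_point :: "('d::finite \<Rightarrow> nat \<Rightarrow> real) \<Rightarrow> ('d \<Rightarrow> nat) \<Rightarrow> real ^ 'd" where
  "grid_point a p = (\<chi> i. a i (p i))"

definition staircase_value ::
    "(real ^ 'd \<Rightarrow> real) \<Rightarrow> ('d::finite \<Rightarrow> nat \<Rightarrow> real) \<Rightarrow>
     real ^ 'n::finite node ^ 'd \<Rightarrow> 'd list \<Rightarrow> real" where
  "staircase_value g a l \<omega> =
     g (grid_point a (grid_path \<omega> 0)) +
     (\<Sum>i\<in>UNIV. \<Sum>t | t \<in> {1..CARD('d) * CARD('n)} \<and> \<omega> ! (t - 1) = i.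
        (g (grid_point a (grid_path \<omega> t)) - g (grid_point a (grid_path \<omega> (t - 1)))) *
        (\<Sum>j\<in>{grid_path \<omega> t i..CARD('n)}. l $ i $n j))"

text \<open>\<open>\<eta> t k\<close> is the \<open>k\<close>-th component of \<open>\<eta>\<^sup>(\<^sup>t\<^sup>)\<close>, for \<open>t \<in> {0..n+1}\<close> and \<open>k \<in> {1..nbits n}\<close>.\<close>

definition gray_code :: "nat \<Rightarrow> (nat \<Rightarrow> nat \<Rightarrow> nat) \<Rightarrow> bool" where
  "gray_code n \<eta> \<longleftrightarrow>
     (\<forall>t\<in>{1..n}. \<forall>k\<in>{1..nbits n}. \<eta> t k \<in> {0, 1}) \<and>
     (\<forall>s\<in>{1..n}. \<forall>t\<in>{1..n}. s \<noteq> t \<longrightarrow> (\<exists>k\<in>{1..nbits n}. \<eta> s k \<noteq> \<eta> t k)) \<and>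
     (\<forall>t\<in>{1..<n}. card {k\<in>{1..nbits n}. \<eta> t k \<noteq> \<eta> (t + 1) k} \<le> 1) \<and>
     (\<forall>k\<in>{1..nbits n}. \<eta> 0 k = \<eta> 1 k \<and> \<eta> (n + 1) k = \<eta> n k)"

definition L_set :: "nat \<Rightarrow> (nat \<Rightarrow> nat \<Rightarrow> nat) \<Rightarrow> nat \<Rightarrow> nat set" where
  "L_set n \<eta> k = {j\<in>{0..n}. \<eta> j k = 1 \<or> \<eta> (j + 1) k = 1}"

definition R_set :: "nat \<Rightarrow> (nat \<Rightarrow> nat \<Rightarrow> nat) \<Rightarrow> nat \<Rightarrow> nat set" where
  "R_set n \<eta> k = {j\<in>{0..n}. \<eta> j k = 0 \<or> \<eta> (j + 1) k = 0}"

text \<open>\<open>D\<close> is the range of the \<open>\<delta>\<^sub>i\<^sub>k\<close>: \<open>{0, 1}\<close>, or \<open>{0..1}\<close> for the continuous relaxation.\<close>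

definition LOG :: "real set \<Rightarrow> (nat \<Rightarrow> nat \<Rightarrow> nat) \<Rightarrow> (real ^ 'n::finite logcoord) set" where
  "LOG D \<eta> = {z. lam_part z \<in> prob_simplex \<and>
     (\<forall>k\<in>{1..nbits (CARD('n))}. delta_part z k \<in> D \<and>
        (\<Sum>j\<in>{0..CARD('n)} - L_set (CARD('n)) \<eta> k. lam_part z $n j) \<le> delta_part z k \<and>
        delta_part z k \<le> 1 - (\<Sum>j\<in>{0..CARD('n)} - R_set (CARD('n)) \<eta> k. lam_part z $n j))}"

definition boxes :: "nat \<Rightarrow> ('d::finite \<Rightarrow> nat \<Rightarrow> real) \<Rightarrow> (real ^ 'd) set set" where
  "boxes n a =
     {{x. \<forall>i. x $ i \<in> {a i (t i - 1)..a i (t i)}} | t. \<forall>i. t i \<in> {1..n}}"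

definition hyp :: "(real ^ 'd \<Rightarrow> real ^ 'k) \<Rightarrow> (real ^ 'd::finite) set \<Rightarrow>
    ((real ^ 'd) \<times> (real ^ 'k::finite)) set" where
  "hyp \<theta> H = {(f, \<mu>). (\<forall>k. \<mu> $ k \<le> \<theta> f $ k) \<and> f \<in> H}"

text \<open>
  Points are \<open>((f, \<mu>), w)\<close> where \<open>w $ i\<close> is \<open>(\<lambda>\<^sub>i, \<delta>\<^sub>i)\<close>.
\<close>

definition log_model :: "real set \<Rightarrow> (real ^ 'd \<Rightarrow> real ^ 'k) \<Rightarrow> ('d::finite \<Rightarrow> nat \<Rightarrow> real) \<Rightarrow>
    ('d \<Rightarrow> nat \<Rightarrow> nat \<Rightarrow> nat) \<Rightarrow>
    (((real ^ 'd) \<times> (real ^ 'k::finite)) \<times> (real ^ 'n::finite logcoord ^ 'd)) set" where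
  "log_model D \<theta> a \<eta> = {((f, \<mu>), w).
     let l = (\<chi> i. lam_part (w $ i)) in
       (\<forall>k. ereal (\<mu> $ k) \<le> conc_env Lambda (\<lambda>l'. ereal (\<theta> (A_map a l') $ k)) l) \<and>
       f = A_map a l \<and>
       (\<forall>i. w $ i \<in> LOG D (\<eta> i))}"

text \<open>The unit vectors of the coordinates \<open>\<delta>\<^sub>i\<^sub>k\<close>.\<close>

definition delta_basis :: "(real ^ 'n::finite logcoord ^ 'd::finite) set" where
  "delta_basis = {axis i (axis (Abs_logcoord (Inr k)) 1) | i k. k \<in> {1..nbits (CARD('n))}}"

text \<open>
  The auxiliary continuous and binary variables form one vector \<open>w\<close>; the binary
  ones are the coordinates \<open>w \<bullet> b\<close> with \<open>b \<in> B\<close>, so that \<open>B\<close> may be empty.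
\<close>

definition mip_formulation :: "'x::euclidean_space set \<Rightarrow> ('x \<times> 'w::euclidean_space) set \<Rightarrow>
    ('x \<times> 'w) set \<Rightarrow> 'w set \<Rightarrow> bool" where
  "mip_formulation S E R B \<longleftrightarrow> B \<subseteq> Basis \<and>
     E = R \<inter> {(x, w). \<forall>b\<in>B. w \<bullet> b \<in> {0, 1}} \<and> S = fst ` E"

definition ideal_relaxation :: "('x::euclidean_space \<times> 'w::euclidean_space) set \<Rightarrow> 'w set \<Rightarrow> bool" where
  "ideal_relaxation R B \<longleftrightarrow> (\<forall>(x, w) \<in> vert R. \<forall>b\<in>B. w \<bullet> b \<in> {0, 1})"

definition ideal_MILP_formulation :: "'x::euclidean_space set \<Rightarrow>
    ('x \<times> 'w::euclidean_space) set \<Rightarrow> ('x \<times> 'w) set \<Rightarrow> 'w set \<Rightarrow> bool" where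
  "ideal_MILP_formulation S E R B \<longleftrightarrow>
     mip_formulation S E R B \<and> polyhedron R \<and> ideal_relaxation R B"

end

theory Submission
  imports Defs
begin

text \<open>
  On the grid, \<open>\<theta>\<^sub>k\<close> gives a supermodular function \<open>G\<close>. For every \<open>\<omega> \<in> \<Omega>\<close> the staircase function is an
  affine function of \<open>\<lambda>\<close> which agrees with \<open>G\<close> along the path of \<open>\<omega>\<close> and, by supermodularity, dominates
  \<open>G\<close> at all vertices of \<open>\<Lambda>\<close>. Conversely, let \<open>\<omega>\<close> list the tail sums \<open>\<lambda>\<^sub>i\<^sub>j + \<dots> + \<lambda>\<^sub>i\<^sub>n\<close> in decreasing order:
  then \<open>\<lambda>\<close> is a convex combination of the vertices on the path of \<open>\<omega>\<close> (the comonotone coupling), so that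
  this staircase function is a lower bound of the envelope at \<open>\<lambda>\<close>. Extendability from the vertices makes
  every staircase function a majorant of \<open>\<theta>\<^sub>k \<circ> A\<close> itself. The same decomposition of \<open>\<lambda>\<close>, which serves all \<open>k\<close>
  at once, yields the integrality of the extreme points and the projection.
\<close>

section \<open>Staircase paths\<close>

text \<open>Extendability is assumed on Q, whereas the model lives in the barycentric coordinates
  \<lambda>. The linear map from \<Lambda> to Q that links them turns a difference of neighbouring
  coordinates into a grid gap times a tail sum. Affine functions of the tail sums are therefore
  affine on Q; the division by the gap relies on the strict growth of each \<open>a i\<close>. Tail
  sums sort consistently: within one direction they decrease, so that a merge of the d lists is a
  lattice path. The consecutive differences of the merged list, with 1 put in front and 0 at the
  end, are the weights of the decomposition; sortedness is exactly their nonnegativity. The obstacle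
  to integrality is that \<delta> is not determined by \<lambda>, so that a decomposition of
  \<lambda> does not say how to split \<delta>. The way out is to write each entry of \<delta> in
  direction i as a mean, under the distribution given by row i of \<lambda>, of a function of the
  node alone. The decomposition has these rows as its marginals and hence reproduces all such
  means.\<close>

lemma grid_path_eq_count: "t \<le> length \<omega> \<Longrightarrow> grid_path \<omega> t i = count_list (take t \<omega>) i"
  by (induction t) (auto simp: take_Suc_conv_app_nth)

lemma grid_path_append: "t \<le> length \<omega> \<Longrightarrow> grid_path (\<omega> @ \<omega>') t = grid_path \<omega> t"
  by (rule ext) (simp add: grid_path_eq_count)

lemma grid_path_mono: "s \<le> t \<Longrightarrow> grid_path \<omega> s i \<le> grid_path \<omega> t i"
  by (rule lift_Suc_mono_le[of "\<lambda>t. grid_path \<omega> t i"]) auto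

lemma grid_path_directions_last:
  fixes \<omega> :: "'d::finite list"
  assumes "\<omega> \<in> directions n"
  shows "grid_path \<omega> (CARD('d) * n) i = n"
  using assms grid_path_eq_count[of "CARD('d) * n" \<omega> i] by (auto simp: directions_def)

lemma grid_path_directions_le:
  fixes \<omega> :: "'d::finite list"
  assumes "\<omega> \<in> directions n" "t \<le> CARD('d) * n"
  shows "grid_path \<omega> t i \<le> n"
  using grid_path_mono[OF assms(2)] grid_path_directions_last[OF assms(1)] by metis

lemma finite_directions: "finite (directions n :: 'd::finite list set)"
  by (rule finite_subset[OF _ finite_lists_length_eq[of UNIV "CARD('d) * n"]])
    (auto simp: directions_def)

text \<open>The steps in direction \<open>i\<close> raise coordinate \<open>i\<close> through 1, 2,
  and so on, hitting each level once, so that a sum over these steps can be indexed by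
  levels.\<close>

lemma sum_along_direction:
  "(\<Sum>t<length \<omega>. if \<omega> ! t = i then f (grid_path \<omega> (Suc t) i) else 0) =
   (\<Sum>j=1..count_list \<omega> i. f j :: 'b::comm_monoid_add)"
proof (induction \<omega> rule: rev_induct)
  case (snoc x \<omega>)
  have "(\<Sum>t<length \<omega>. if (\<omega> @ [x]) ! t = i then f (grid_path (\<omega> @ [x]) (Suc t) i) else 0)
      = (\<Sum>t<length \<omega>. if \<omega> ! t = i then f (grid_path \<omega> (Suc t) i) else 0)"
    by (rule sum.cong) (auto simp: grid_path_append nth_append simp del: grid_path.simps)
  moreover have "grid_path (\<omega> @ [x]) (Suc (length \<omega>)) i = count_list (\<omega> @ [x]) i"
    by (subst grid_path_eq_count) auto
  ultimately show ?case
    using snoc by (auto simp del: grid_path.simps)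
qed auto

text \<open>Abel summation. It is applied to the sorted tail sums along a path and to the tail sums
  of a single coordinate, which brings both sides of the marginal identity into the same
  shape.\<close>

lemma sum_by_parts:
  fixes Z F :: "nat \<Rightarrow> real"
  shows "(\<Sum>t\<le>m. (Z t - Z (Suc t)) * F t) =
    Z 0 * F 0 - Z (Suc m) * F m + (\<Sum>t<m. Z (Suc t) * (F (Suc t) - F t))"
  by (induction m) (auto simp: algebra_simps)

lemma greedy_directions:
  fixes z :: "'d::finite \<Rightarrow> nat \<Rightarrow> real"
  assumes "t \<le> CARD('d) * n"
  shows "\<exists>\<omega>. length \<omega> = t \<and> (\<forall>i. count_list \<omega> i \<le> n) \<and>
    (\<forall>s<t. \<forall>i. grid_path \<omega> s i < n \<longrightarrow>
       z i (Suc (grid_path \<omega> s i)) \<le> z (\<omega> ! s) (Suc (grid_path \<omega> s (\<omega> ! s))))"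
  using assms
proof (induction t)
  case (Suc t)
  then obtain \<omega> where len: "length \<omega> = t" and cnt: "\<And>i. count_list \<omega> i \<le> n"
    and greedy: "\<And>s i. s < t \<Longrightarrow> grid_path \<omega> s i < n \<Longrightarrow>
       z i (Suc (grid_path \<omega> s i)) \<le> z (\<omega> ! s) (Suc (grid_path \<omega> s (\<omega> ! s)))"
    by auto
  let ?I = "{i. count_list \<omega> i < n}"
  \<comment> \<open>Some direction is not yet exhausted: otherwise the word would already have full
    length.\<close>
  have "?I \<noteq> {}"
  proof
    assume "?I = {}"
    then have "\<And>i. count_list \<omega> i = n"
      using cnt by (metis (mono_tags, lifting) empty_iff le_neq_implies_less mem_Collect_eq)
    moreover have "sum (count_list \<omega>) UNIV = t"
      using sum_count_set[of \<omega> UNIV] len by auto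
    ultimately have "CARD('d) * n = t" by simp
    with Suc.prems show False by simp
  qed
  let ?h = "\<lambda>i. z i (Suc (count_list \<omega> i))"
  have "Max (?h ` ?I) \<in> ?h ` ?I"
    using \<open>?I \<noteq> {}\<close> by (intro Max_in) auto
  then obtain x where x: "x \<in> ?I" "Max (?h ` ?I) = ?h x" by auto
  have max: "?h i \<le> ?h x" if "count_list \<omega> i < n" for i
    using that x(2)[symmetric] by auto
  have gp: "grid_path \<omega> t = count_list \<omega>"
    by (rule ext) (simp add: grid_path_eq_count len)
  have app: "grid_path (\<omega> @ [x]) s = grid_path \<omega> s" if "s \<le> t" for s
    using that len by (simp add: grid_path_append)
  show ?case
  proof (intro exI[of _ "\<omega> @ [x]"] conjI allI impI)
    fix i show "count_list (\<omega> @ [x]) i \<le> n"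
      using cnt[of i] x(1) by auto
  next
    fix s i assume "s < Suc t" "grid_path (\<omega> @ [x]) s i < n"
    then show "z i (Suc (grid_path (\<omega> @ [x]) s i)) \<le>
        z ((\<omega> @ [x]) ! s) (Suc (grid_path (\<omega> @ [x]) s ((\<omega> @ [x]) ! s)))"
      using max[of i] greedy[of s i] len
      by (cases "s = t") (auto simp: app gp nth_append)
  qed (simp add: len)
qed auto

lemma sorting_directions:
  fixes z :: "'d::finite \<Rightarrow> nat \<Rightarrow> real"
  assumes anti: "\<And>i j. z i (Suc j) \<le> z i j"
  obtains \<omega> where "\<omega> \<in> directions n"
    "\<And>s. Suc s < CARD('d) * n \<Longrightarrow>
       z (\<omega> ! Suc s) (grid_path \<omega> (Suc (Suc s)) (\<omega> ! Suc s)) \<le>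
       z (\<omega> ! s) (grid_path \<omega> (Suc s) (\<omega> ! s))"
proof -
  obtain \<omega> where len: "length \<omega> = CARD('d) * n" and cnt: "\<And>i. count_list \<omega> i \<le> n"
    and greedy: "\<And>s i. s < CARD('d) * n \<Longrightarrow> grid_path \<omega> s i < n \<Longrightarrow>
       z i (Suc (grid_path \<omega> s i)) \<le> z (\<omega> ! s) (Suc (grid_path \<omega> s (\<omega> ! s)))"
    using greedy_directions[of "CARD('d) * n" n z] by auto
  have "sum (count_list \<omega>) UNIV = (\<Sum>i\<in>(UNIV :: 'd set). n)"
    using sum_count_set[of \<omega> UNIV] len by simp
  \<comment> \<open>The counts are at most \<open>n\<close> and add up to the sum of these upper
    bounds, so none of them can be smaller.\<close>
  then have "count_list \<omega> i = n" for i
    using sum_mono_inv[of "count_list \<omega>" UNIV "\<lambda>_. n" i] cnt by auto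
  then have \<omega>: "\<omega> \<in> directions n"
    using len by (auto simp: directions_def)
  moreover have "z (\<omega> ! Suc s) (grid_path \<omega> (Suc (Suc s)) (\<omega> ! Suc s)) \<le>
       z (\<omega> ! s) (grid_path \<omega> (Suc s) (\<omega> ! s))" if s: "Suc s < CARD('d) * n" for s
  proof (cases "\<omega> ! Suc s = \<omega> ! s")
    case True
    then show ?thesis using anti by simp
  next
    case False
    \<comment> \<open>Step \<open>s\<close> leaves the direction of step \<open>Suc s\<close>
      untouched. That direction was thus available at step \<open>s\<close> with the same head, and
      the greedy choice preferred another one.\<close>
    have "grid_path \<omega> (Suc (Suc s)) (\<omega> ! Suc s) \<le> n"
      using grid_path_directions_le[OF \<omega>] s by (metis Suc_leI)
    with False show ?thesis using greedy[of s "\<omega> ! Suc s"] s by simp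
  qed
  ultimately show ?thesis using that by blast
qed

lemma directions_nonempty: "(directions n :: 'd::finite list set) \<noteq> {}"
proof -
  obtain \<omega> :: "'d list" where "\<omega> \<in> directions n"
    using sorting_directions[of "\<lambda>_ _. 0" n] by auto
  then show ?thesis by auto
qed

section \<open>The staircase functions on the product of simplices\<close>

text \<open>With row \<open>i\<close> of \<open>l\<close> read as a probability distribution on the
  nodes, this is its survival function.\<close>

definition tail_sum :: "real ^ 'n::finite node ^ 'd::finite \<Rightarrow> 'd \<Rightarrow> nat \<Rightarrow> real" where
  "tail_sum l i j = (\<Sum>m\<in>{j..CARD('n)}. l $ i $n m)"

text \<open>For \<open>p\<close> bounded by n these are the vertices of \<Lambda>, indexed by grid
  points.\<close>

definition unit_lam :: "('d::finite \<Rightarrow> nat) \<Rightarrow> real ^ 'n::finite node ^ 'd" where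
  "unit_lam p = (\<chi> i j. if Rep_node j = p i then 1 else 0)"

lemma unit_lam_nth [simp]:
  fixes p :: "'d::finite \<Rightarrow> nat"
  assumes "j \<le> CARD('n::finite)"
  shows "(unit_lam p :: real ^ 'n node ^ 'd) $ i $n j = (if j = p i then 1 else 0)"
  using assms by (simp add: unit_lam_def Abs_node_inverse)

lemma node_cases:
  fixes j :: "'n::finite node"
  obtains m where "m \<le> CARD('n)" "j = Abs_node m"
  by (cases j) auto

lemma node_vec_eqI:
  fixes x y :: "real ^ 'n::finite node"
  assumes "\<And>j. j \<le> CARD('n) \<Longrightarrow> x $n j = y $n j"
  shows "x = y"
  by (metis assms node_cases vec_eq_iff)

lemma Lambda_nonneg: "l \<in> Lambda \<Longrightarrow> 0 \<le> l $ i $ j"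
  by (simp add: Lambda_def prob_simplex_def)

lemma Lambda_sum:
  "(l :: real ^ 'n::finite node ^ 'd::finite) \<in> Lambda \<Longrightarrow> (\<Sum>j\<in>{0..CARD('n)}. l $ i $n j) = 1"
  by (simp add: Lambda_def prob_simplex_def)

lemma unit_lam_in_Lambda:
  fixes p :: "'d::finite \<Rightarrow> nat"
  assumes "\<And>i. p i \<le> CARD('n::finite)"
  shows "(unit_lam p :: real ^ 'n node ^ 'd) \<in> Lambda"
proof -
  have "(\<Sum>j\<in>{0..CARD('n)}. (unit_lam p :: real ^ 'n node ^ 'd) $ i $n j) = 1" for i
  proof -
    have "(\<Sum>j\<in>{0..CARD('n)}. (unit_lam p :: real ^ 'n node ^ 'd) $ i $n j)
        = (\<Sum>j\<in>{0..CARD('n)}. if j = p i then 1 else 0)"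
      by (rule sum.cong) auto
    then show ?thesis using assms by simp
  qed
  then show ?thesis
    by (auto simp: Lambda_def prob_simplex_def unit_lam_def)
qed

lemma A_map_unit_lam:
  fixes p :: "'d::finite \<Rightarrow> nat"
  assumes "\<And>i. p i \<le> CARD('n::finite)"
  shows "A_map a (unit_lam p :: real ^ 'n node ^ 'd) = grid_point a p"
proof -
  have "(\<Sum>j\<in>{0..CARD('n)}. a i j * (unit_lam p :: real ^ 'n node ^ 'd) $ i $n j) = a i (p i)" for i
  proof -
    have "(\<Sum>j\<in>{0..CARD('n)}. a i j * (unit_lam p :: real ^ 'n node ^ 'd) $ i $n j)
        = (\<Sum>j\<in>{0..CARD('n)}. if j = p i then a i j else 0)"
      by (rule sum.cong) auto
    then show ?thesis using assms by simp
  qed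
  then show ?thesis by (simp add: A_map_def grid_point_def)
qed

lemma linear_A_map: "linear (A_map a)"
  by (rule linearI)
    (auto simp: A_map_def vec_eq_iff sum.distrib[symmetric] sum_distrib_left algebra_simps
      intro!: sum.cong)

lemma tail_sum_unit_lam:
  fixes p :: "'d::finite \<Rightarrow> nat"
  assumes "p i \<le> CARD('n::finite)"
  shows "tail_sum (unit_lam p :: real ^ 'n node ^ 'd) i j = (if j \<le> p i then 1 else 0)"
proof -
  have "tail_sum (unit_lam p :: real ^ 'n node ^ 'd) i j
      = (\<Sum>m\<in>{j..CARD('n)}. if m = p i then 1 else 0)"
    unfolding tail_sum_def by (rule sum.cong) auto
  then show ?thesis using assms by auto
qed

lemma tail_sum_Suc:
  fixes l :: "real ^ 'n::finite node ^ 'd::finite"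
  shows "j \<le> CARD('n) \<Longrightarrow> tail_sum l i j = l $ i $n j + tail_sum l i (Suc j)"
  unfolding tail_sum_def by (rule sum.atLeast_Suc_atMost)

lemma tail_sum_eq_0:
  fixes l :: "real ^ 'n::finite node ^ 'd::finite"
  shows "CARD('n) < j \<Longrightarrow> tail_sum l i j = 0"
  unfolding tail_sum_def by simp

lemma tail_sum_antimono:
  fixes l :: "real ^ 'n::finite node ^ 'd::finite"
  assumes "l \<in> Lambda"
  shows "tail_sum l i (Suc j) \<le> tail_sum l i j"
  by (cases "j \<le> CARD('n)") (simp_all add: tail_sum_Suc tail_sum_eq_0 Lambda_nonneg[OF assms])

lemma tail_sum_bounds:
  assumes "l \<in> Lambda"
  shows "0 \<le> tail_sum l i j" "tail_sum l i j \<le> 1"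
proof -
  show "0 \<le> tail_sum l i j"
    unfolding tail_sum_def by (intro sum_nonneg Lambda_nonneg assms)
  have "tail_sum l i j \<le> tail_sum l i 0"
    by (rule lift_Suc_antimono_le[of "tail_sum l i"]) (auto intro: tail_sum_antimono assms)
  then show "tail_sum l i j \<le> 1"
    using Lambda_sum[OF assms, of i] by (simp add: tail_sum_def)
qed

text \<open>Grouping by direction is undone, leaving one sum over steps. The index now starts at 0,
  so that step \<open>t\<close> leads from path point \<open>t\<close> to path point
  \<open>Suc t\<close>.\<close>

lemma staircase_value_steps:
  fixes a :: "'d::finite \<Rightarrow> nat \<Rightarrow> real" and l :: "real ^ 'n::finite node ^ 'd"
  shows "staircase_value g a l \<omega> = g (grid_point a (grid_path \<omega> 0)) +
    (\<Sum>t<CARD('d) * CARD('n).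
      (g (grid_point a (grid_path \<omega> (Suc t))) - g (grid_point a (grid_path \<omega> t))) *
      tail_sum l (\<omega> ! t) (grid_path \<omega> (Suc t) (\<omega> ! t)))"
proof -
  let ?h = "\<lambda>t. (g (grid_point a (grid_path \<omega> t)) - g (grid_point a (grid_path \<omega> (t - 1)))) *
      tail_sum l (\<omega> ! (t - 1)) (grid_path \<omega> t (\<omega> ! (t - 1)))"
  have "(\<Sum>i\<in>UNIV. \<Sum>t | t \<in> {1..CARD('d) * CARD('n)} \<and> \<omega> ! (t - 1) = i.
        (g (grid_point a (grid_path \<omega> t)) - g (grid_point a (grid_path \<omega> (t - 1)))) *
        (\<Sum>j\<in>{grid_path \<omega> t i..CARD('n)}. l $ i $n j))
     = (\<Sum>i\<in>UNIV. sum ?h {t \<in> {1..CARD('d) * CARD('n)}. \<omega> ! (t - 1) = i})"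
    by (intro sum.cong refl) (auto simp: tail_sum_def)
  also have "\<dots> = sum ?h {1..CARD('d) * CARD('n)}"
    by (rule sum.group) auto
  also have "\<dots> = (\<Sum>t<CARD('d) * CARD('n). ?h (Suc t))"
    by (simp only: One_nat_def sum.atLeast1_atMost_eq)
  finally show ?thesis
    by (simp add: staircase_value_def)
qed

text \<open>The comonotone coupling as weights \<open>w\<close> on the points of one path. The
  clause on \<open>u\<close> says that its \<open>i\<close>-th marginal is row \<open>i\<close> of
  \<open>l\<close>, tested against every function of the node; the last clause says that the
  staircase value is the mean of \<open>g\<close> along the path. Quantifying over \<open>u\<close>,
  \<open>g\<close> and \<open>a\<close> inside lets one pair \<open>\<omega>\<close>,
  \<open>w\<close> serve all components of \<theta> and all entries of \<delta>.\<close>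

definition staircase_decomposition ::
    "real ^ 'n::finite node ^ 'd::finite \<Rightarrow> 'd list \<Rightarrow> (nat \<Rightarrow> real) \<Rightarrow> bool" where
  "staircase_decomposition l \<omega> w \<longleftrightarrow> \<omega> \<in> directions (CARD('n)) \<and>
     (\<forall>t\<le>CARD('d) * CARD('n). 0 \<le> w t) \<and>
     (\<Sum>t\<le>CARD('d) * CARD('n). w t) = 1 \<and>
     l = (\<Sum>t\<le>CARD('d) * CARD('n). w t *\<^sub>R unit_lam (grid_path \<omega> t)) \<and>
     (\<forall>u i. (\<Sum>t\<le>CARD('d) * CARD('n). w t * u (grid_path \<omega> t i)) =
       (\<Sum>j\<in>{0..CARD('n)}. l $ i $n j * u j)) \<and>
     (\<forall>g a. staircase_value g a l \<omega> =
       (\<Sum>t\<le>CARD('d) * CARD('n). w t * g (grid_point a (grid_path \<omega> t))))"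

lemma Lambda_decomposition:
  fixes l :: "real ^ 'n::finite node ^ 'd::finite"
  assumes l: "l \<in> Lambda"
  shows "\<exists>\<omega> w. staircase_decomposition l \<omega> w"
proof -
  let ?N = "CARD('n)" let ?M = "CARD('d) * CARD('n)"
  obtain \<omega> where \<omega>: "\<omega> \<in> directions ?N" and sorted: "\<And>s. Suc s < ?M \<Longrightarrow>
       tail_sum l (\<omega> ! Suc s) (grid_path \<omega> (Suc (Suc s)) (\<omega> ! Suc s)) \<le>
       tail_sum l (\<omega> ! s) (grid_path \<omega> (Suc s) (\<omega> ! s))"
    using sorting_directions[of "tail_sum l" ?N] tail_sum_antimono[OF l] by blast
  \<comment> \<open>The sorted list of all tail sums, padded by 1 in front and 0 at the end. The
    weights \<open>w\<close> are its consecutive drops, hence nonnegative with total 1.\<close>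
  define Z where "Z t = (case t of 0 \<Rightarrow> 1 | Suc s \<Rightarrow>
    if s < ?M then tail_sum l (\<omega> ! s) (grid_path \<omega> (Suc s) (\<omega> ! s)) else 0)" for t
  have Z0: "Z 0 = 1" and ZM: "Z (Suc ?M) = 0"
    by (simp_all add: Z_def)
  have ZS: "Z (Suc t) = tail_sum l (\<omega> ! t) (grid_path \<omega> (Suc t) (\<omega> ! t))" if "t < ?M" for t
    using that by (simp add: Z_def)
  define w where "w t = Z t - Z (Suc t)" for t
  have parts: "(\<Sum>t\<le>?M. w t * F t) = F 0 + (\<Sum>t<?M. Z (Suc t) * (F (Suc t) - F t))" for F
    unfolding w_def sum_by_parts Z0 ZM by simp
  have len: "length \<omega> = ?M" and cnt: "\<And>i. count_list \<omega> i = ?N"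
    using \<omega> by (auto simp: directions_def)
  \<comment> \<open>Both sides are summed by parts. Along the path \<open>u\<close> changes only at
    steps in direction \<open>i\<close>, and these run once through the levels 1 to n.\<close>
  have marginal: "(\<Sum>t\<le>?M. w t * u (grid_path \<omega> t i)) = (\<Sum>j\<le>?N. l $ i $n j * u j)" for u i
  proof -
    have "(\<Sum>t<?M. Z (Suc t) * (u (grid_path \<omega> (Suc t) i) - u (grid_path \<omega> t i)))
      = (\<Sum>t<length \<omega>. if \<omega> ! t = i then
          (\<lambda>j. tail_sum l i j * (u j - u (j - 1))) (grid_path \<omega> (Suc t) i) else 0)"
      unfolding len by (rule sum.cong) (auto simp: ZS)
    also have "\<dots> = (\<Sum>j=1..?N. tail_sum l i j * (u j - u (j - 1)))"
      using sum_along_direction[of \<omega> i "\<lambda>j. tail_sum l i j * (u j - u (j - 1))"] cnt by simp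
    also have "\<dots> = (\<Sum>j<?N. tail_sum l i (Suc j) * (u (Suc j) - u j))"
      by (simp only: One_nat_def sum.atLeast1_atMost_eq diff_Suc_Suc diff_zero)
    finally have *: "(\<Sum>t<?M. Z (Suc t) * (u (grid_path \<omega> (Suc t) i) - u (grid_path \<omega> t i)))
      = (\<Sum>j<?N. tail_sum l i (Suc j) * (u (Suc j) - u j))" .
    have "(\<Sum>j\<le>?N. l $ i $n j * u j) = (\<Sum>j\<le>?N. (tail_sum l i j - tail_sum l i (Suc j)) * u j)"
      by (rule sum.cong) (auto simp: tail_sum_Suc)
    also have "\<dots> = u 0 + (\<Sum>j<?N. tail_sum l i (Suc j) * (u (Suc j) - u j))"
      using Lambda_sum[OF l, of i]
      by (subst sum_by_parts) (simp add: tail_sum_eq_0 tail_sum_def)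
    finally show ?thesis
      using * parts[of "\<lambda>t. u (grid_path \<omega> t i)"] by simp
  qed
  show ?thesis
    unfolding staircase_decomposition_def
  proof (intro exI[of _ \<omega>] exI[of _ w] conjI allI impI \<omega>)
    show "0 \<le> w t" if "t \<le> ?M" for t
    proof (cases t)
      case 0
      then show ?thesis
        using tail_sum_bounds[OF l] by (simp add: w_def Z_def)
    next
      case (Suc s)
      show ?thesis
      proof (cases "t < ?M")
        case True
        then show ?thesis
          using Suc sorted[of s] ZS[of s] ZS[of t] by (simp add: w_def del: grid_path.simps)
      next
        case False
        with that have "t = ?M" by simp
        then show ?thesis
          using Suc ZS[of s] ZM tail_sum_bounds(1)[OF l] by (simp add: w_def del: grid_path.simps)
      qed
    qed
    show "(\<Sum>t\<le>?M. w t) = 1"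
      using parts[of "\<lambda>_. 1"] by simp
    show "l = (\<Sum>t\<le>?M. w t *\<^sub>R unit_lam (grid_path \<omega> t))"
    proof (subst vec_eq_iff, intro allI node_vec_eqI)
      fix i j assume j: "j \<le> ?N"
      have "(\<Sum>t\<le>?M. w t *\<^sub>R (unit_lam (grid_path \<omega> t) :: real ^ 'n node ^ 'd)) $ i $n j
        = (\<Sum>t\<le>?M. w t * (if j = grid_path \<omega> t i then 1 else 0))"
        using j by simp
      also have "\<dots> = (\<Sum>m\<le>?N. l $ i $n m * (if j = m then 1 else 0))"
        by (rule marginal)
      also have "\<dots> = (\<Sum>m\<le>?N. if j = m then l $ i $n m else 0)"
        by (rule sum.cong) auto
      finally show "l $ i $n j =
          (\<Sum>t\<le>?M. w t *\<^sub>R (unit_lam (grid_path \<omega> t) :: real ^ 'n node ^ 'd)) $ i $n j"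
        using j by simp
    qed
    show "(\<Sum>t\<le>?M. w t * u (grid_path \<omega> t i)) = (\<Sum>j\<in>{0..?N}. l $ i $n j * u j)" for u i
      unfolding atLeast0AtMost by (rule marginal)
    show "staircase_value g a l \<omega> = (\<Sum>t\<le>?M. w t * g (grid_point a (grid_path \<omega> t)))" for g a
    proof -
      have "(\<Sum>t<?M. Z (Suc t) *
            (g (grid_point a (grid_path \<omega> (Suc t))) - g (grid_point a (grid_path \<omega> t))))
        = (\<Sum>t<?M. (g (grid_point a (grid_path \<omega> (Suc t))) - g (grid_point a (grid_path \<omega> t))) *
            tail_sum l (\<omega> ! t) (grid_path \<omega> (Suc t) (\<omega> ! t)))"
        by (rule sum.cong) (auto simp: ZS mult.commute simp del: grid_path.simps)
      then show ?thesis
        unfolding parts[of "\<lambda>t. g (grid_point a (grid_path \<omega> t))"] staircase_value_steps by simp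
    qed
  qed
qed

text \<open>The path is cut off at \<open>q\<close>: its meets \<open>r t\<close> with
  \<open>q\<close> climb from the origin to \<open>q\<close>, and the value at \<open>q\<close>
  telescopes along them. As long as a step stays below \<open>q\<close>, \<open>r (Suc t)\<close>
  and \<open>?p t\<close> have join \<open>?p (Suc t)\<close> and meet \<open>r t\<close>, so that
  supermodularity bounds the increment along \<open>r\<close> by the one along the path, whose tail
  sum is 1. Once the step exceeds \<open>q\<close>, \<open>r\<close> rests and the tail sum is
  0.\<close>

lemma staircase_value_ge_at_vertex:
  fixes a :: "'d::finite \<Rightarrow> nat \<Rightarrow> real" and q :: "'d \<Rightarrow> nat"
  assumes sm: "supermodular_on {fL..fU} g"
    and fL: "\<And>i. fL $ i = a i 0" and fU: "\<And>i. fU $ i = a i (CARD('n::finite))"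
    and a: "\<And>i. mono_on {0..CARD('n)} (a i)"
    and \<omega>: "\<omega> \<in> directions (CARD('n))" and q: "\<And>i. q i \<le> CARD('n)"
  shows "g (grid_point a q) \<le> staircase_value g a (unit_lam q :: real ^ 'n node ^ 'd) \<omega>"
proof -
  let ?N = "CARD('n)" let ?M = "CARD('d) * CARD('n)"
  let ?p = "grid_path \<omega>"
  define r where "r t i = min (?p t i) (q i)" for t i
  define G where "G p = g (grid_point a p)" for p
  have super: "G p + G p' \<le> G (\<lambda>i. max (p i) (p' i)) + G (\<lambda>i. min (p i) (p' i))"
    if p: "\<And>i. p i \<le> ?N" and p': "\<And>i. p' i \<le> ?N" for p p'
  proof -
    have in_box: "grid_point a p \<in> {fL..fU}" if "\<And>i. p i \<le> ?N" for p
      using that mono_onD[OF a] by (auto simp: less_eq_vec_def grid_point_def fL fU)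
    \<comment> \<open>Monotone \<open>a i\<close> commute with \<open>max\<close> and
      \<open>min\<close>, so the grid is a sublattice of the box.\<close>
    have "sup (grid_point a p) (grid_point a p') = grid_point a (\<lambda>i. max (p i) (p' i))"
      "inf (grid_point a p) (grid_point a p') = grid_point a (\<lambda>i. min (p i) (p' i))"
      using p p' mono_onD[OF a]
      by (auto simp: vec_eq_iff sup_vec_def inf_vec_def grid_point_def max_def min_def sup_real_def
          inf_real_def intro: antisym)
    moreover have "g (grid_point a p) + g (grid_point a p') \<le>
        g (sup (grid_point a p) (grid_point a p')) + g (inf (grid_point a p) (grid_point a p'))"
      using sm in_box[of p, OF p] in_box[of p', OF p'] unfolding supermodular_on_def by blast
    ultimately show ?thesis
      by (simp add: G_def)
  qed
  have step: "G (r (Suc t)) - G (r t) \<le>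
     (G (?p (Suc t)) - G (?p t)) * tail_sum (unit_lam q :: real ^ 'n node ^ 'd) (\<omega> ! t) (?p (Suc t) (\<omega> ! t))"
    if t: "t < ?M" for t
  proof (cases "?p (Suc t) (\<omega> ! t) \<le> q (\<omega> ! t)")
    case True
    have "(\<lambda>i. max (r (Suc t) i) (?p t i)) = ?p (Suc t)" "(\<lambda>i. min (r (Suc t) i) (?p t i)) = r t"
      using True by (auto simp: r_def fun_eq_iff)
    moreover have "\<And>i. ?p t i \<le> ?N" "\<And>i. r (Suc t) i \<le> ?N"
      using grid_path_directions_le[OF \<omega>, of t] t q by (auto simp: r_def intro: min.coboundedI2)
    ultimately show ?thesis
      using super[of "r (Suc t)" "?p t"] True q
      by (simp add: tail_sum_unit_lam del: grid_path.simps)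
  next
    case False
    then have "r (Suc t) = r t"
      by (auto simp: r_def fun_eq_iff)
    then show ?thesis
      using False q by (simp add: tail_sum_unit_lam del: grid_path.simps)
  qed
  have "r ?M = q"
    by (simp add: r_def fun_eq_iff grid_path_directions_last[OF \<omega>] q min_absorb2)
  then have "G q = G (r 0) + (\<Sum>t<?M. G (r (Suc t)) - G (r t))"
    using sum_lessThan_telescope[of "\<lambda>t. G (r t)" ?M] by simp
  also have "r 0 = ?p 0"
    by (auto simp: r_def)
  also have "(\<Sum>t<?M. G (r (Suc t)) - G (r t)) \<le> (\<Sum>t<?M. (G (?p (Suc t)) - G (?p t)) *
      tail_sum (unit_lam q :: real ^ 'n node ^ 'd) (\<omega> ! t) (?p (Suc t) (\<omega> ! t)))"
    using step by (intro sum_mono) auto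
  finally show ?thesis
    by (simp add: staircase_value_steps G_def)
qed

section \<open>The concave envelope\<close>

lemma linear_tail_sum: "linear (\<lambda>l :: real ^ 'n::finite node ^ 'd::finite. tail_sum l i j)"
  by (rule linearI) (auto simp: tail_sum_def sum.distrib sum_distrib_left)

lemma linear_staircase_value:
  fixes a :: "'d::finite \<Rightarrow> nat \<Rightarrow> real"
  shows "linear (\<lambda>l :: real ^ 'n::finite node ^ 'd.
    staircase_value g a l \<omega> - g (grid_point a (grid_path \<omega> 0)))"
proof -
  have "linear (\<lambda>l :: real ^ 'n node ^ 'd. \<Sum>t<CARD('d) * CARD('n).
      (g (grid_point a (grid_path \<omega> (Suc t))) - g (grid_point a (grid_path \<omega> t))) *
      tail_sum l (\<omega> ! t) (grid_path \<omega> (Suc t) (\<omega> ! t)))"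
    by (intro linear_compose_sum ballI
        linear_compose_scale_right[OF linear_tail_sum, unfolded real_scaleR_def])
  then show ?thesis
    by (simp add: staircase_value_steps del: grid_path.simps)
qed

lemma ereal_concave_on_affine:
  fixes \<phi> :: "'a::real_vector \<Rightarrow> real"
  assumes S: "convex S" and \<phi>: "linear (\<lambda>x. \<phi> x - c)"
  shows "ereal_concave_on S (\<lambda>x. ereal (\<phi> x))"
  unfolding ereal_concave_on_def
proof (rule convexI)
  fix p q :: "'a \<times> real" and u v :: real
  assume "p \<in> {(x, r). x \<in> S \<and> ereal r \<le> ereal (\<phi> x)}"
    "q \<in> {(x, r). x \<in> S \<and> ereal r \<le> ereal (\<phi> x)}" and uv: "0 \<le> u" "0 \<le> v" "u + v = 1"
  then obtain x r y s where pq: "p = (x, r)" "q = (y, s)" "x \<in> S" "y \<in> S" "r \<le> \<phi> x" "s \<le> \<phi> y"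
    by auto
  have "\<phi> (u *\<^sub>R x + v *\<^sub>R y) - c = u * (\<phi> x - c) + v * (\<phi> y - c)"
    using linear_add[OF \<phi>, of "u *\<^sub>R x" "v *\<^sub>R y"] linear_cmul[OF \<phi>, of u x] linear_cmul[OF \<phi>, of v y]
    by (auto simp: linear_scale[OF \<phi>])
  also have "\<dots> = u * \<phi> x + v * \<phi> y - (u + v) * c"
    by (simp add: algebra_simps)
  finally have "\<phi> (u *\<^sub>R x + v *\<^sub>R y) = u * \<phi> x + v * \<phi> y"
    using uv by simp
  moreover have "u * r \<le> u * \<phi> x" "v * s \<le> v * \<phi> y"
    using pq uv by (auto intro: mult_left_mono)
  ultimately show "u *\<^sub>R p + v *\<^sub>R q \<in> {(x, r). x \<in> S \<and> ereal r \<le> ereal (\<phi> x)}"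
    using convexD[OF S pq(3,4) uv] pq by simp
qed

text \<open>Jensen's inequality. Real lower bounds \<open>y t\<close> stand in for the extended
  values \<open>h (x t)\<close>, so that the mean is formed within the reals.\<close>

lemma ereal_concave_on_sum:
  assumes h: "ereal_concave_on S h" and T: "finite T"
    and w: "\<And>t. t \<in> T \<Longrightarrow> 0 \<le> w t" "sum w T = 1"
    and x: "\<And>t. t \<in> T \<Longrightarrow> x t \<in> S" and y: "\<And>t. t \<in> T \<Longrightarrow> ereal (y t) \<le> h (x t)"
  shows "ereal (\<Sum>t\<in>T. w t * y t) \<le> h (\<Sum>t\<in>T. w t *\<^sub>R x t)"
proof -
  have "(\<Sum>t\<in>T. w t *\<^sub>R (x t, y t)) \<in> {(x, r). x \<in> S \<and> ereal r \<le> h x}"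
    using h w x y by (intro convex_sum T) (auto simp: ereal_concave_on_def)
  moreover have "(\<Sum>t\<in>T. w t *\<^sub>R (x t, y t)) = (\<Sum>t\<in>T. w t *\<^sub>R x t, \<Sum>t\<in>T. w t * y t)"
    by (simp add: prod_eq_iff fst_sum snd_sum)
  ultimately show ?thesis by simp
qed

lemma conc_env_le:
  assumes "ereal_concave_on S h" "\<And>y. y \<in> S \<Longrightarrow> g y \<le> h y"
  shows "conc_env S g x \<le> h x"
  unfolding conc_env_def using assms by (intro INF_lower) auto

lemma conc_env_ge:
  assumes "\<And>h. ereal_concave_on S h \<Longrightarrow> (\<And>y. y \<in> S \<Longrightarrow> g y \<le> h y) \<Longrightarrow> c \<le> h x"
  shows "c \<le> conc_env S g x"
  unfolding conc_env_def using assms by (intro INF_greatest) auto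

lemma convex_Lambda: "convex (Lambda :: (real ^ 'n::finite node ^ 'd::finite) set)"
  by (rule convexI)
    (auto simp: Lambda_def prob_simplex_def sum.distrib sum_distrib_left[symmetric] add_nonneg_nonneg)

section \<open>The product Q of simplices and its barycentric coordinates\<close>

lemma convex_Q_prod: "convex (Q_prod a)"
  by (rule convexI) (auto simp: Q_prod_def intro!: convexD[OF convex_convex_hull])

text \<open>An extreme point of a product is extreme in each factor, and the extreme points of a
  convex hull are among its generators.\<close>

lemma vert_Q_prod:
  assumes "s \<in> vert (Q_prod a :: (real ^ 'n::finite node ^ 'd::finite) set)"
  obtains q where "\<And>i. q i \<le> CARD('n)" "\<And>i. s $ i = Q_vertex (a i) (q i)"
proof -
  let ?V = "\<lambda>i. Q_vertex (a i) ` {0..CARD('n)} :: (real ^ 'n node) set"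
  have s: "s \<in> Q_prod a" and ext: "\<And>u v. u \<in> Q_prod a \<Longrightarrow> v \<in> Q_prod a \<Longrightarrow> s \<notin> open_segment u v"
    using assms by (auto simp: vert_def extreme_point_of_def)
  have "s $ i extreme_point_of convex hull ?V i" for i
    unfolding extreme_point_of_def
  proof (intro conjI ballI notI)
    show "s $ i \<in> convex hull ?V i"
      using s by (simp add: Q_prod_def)
    fix u v assume uv: "u \<in> convex hull ?V i" "v \<in> convex hull ?V i" "s $ i \<in> open_segment u v"
    then obtain c where c: "u \<noteq> v" "0 < c" "c < 1" "s $ i = (1 - c) *\<^sub>R u + c *\<^sub>R v"
      by (auto simp: in_segment)
    \<comment> \<open>Only coordinate \<open>i\<close> is replaced by the ends of its segment, which
      places the whole of \<open>s\<close> inside a segment of Q.\<close>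
    let ?u = "\<chi> k. if k = i then u else s $ k" and ?v = "\<chi> k. if k = i then v else s $ k"
    have "?u \<in> Q_prod a" "?v \<in> Q_prod a"
      using uv s by (auto simp: Q_prod_def)
    moreover have "?u \<noteq> ?v"
      using c(1) by (auto simp: vec_eq_iff)
    moreover have "s = (1 - c) *\<^sub>R ?u + c *\<^sub>R ?v"
      using c(4) by (auto simp: vec_eq_iff algebra_simps)
    ultimately show False
      using ext[of ?u ?v] c(2,3) unfolding in_segment by blast
  qed
  then have "\<exists>j. j \<le> CARD('n) \<and> s $ i = Q_vertex (a i) j" for i
    using extreme_point_of_convex_hull[of "s $ i" "?V i"] by auto
  then show ?thesis using that by metis
qed

definition Q_map :: "('d::finite \<Rightarrow> nat \<Rightarrow> real) \<Rightarrow> real ^ 'n::finite node ^ 'd \<Rightarrow> real ^ 'n node ^ 'd" where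
  "Q_map a l = (\<chi> i. \<Sum>j\<in>{0..CARD('n)}. l $ i $n j *\<^sub>R Q_vertex (a i) j)"

lemma Q_map_in_Q_prod:
  assumes "l \<in> Lambda"
  shows "Q_map a l \<in> Q_prod a"
  unfolding Q_prod_def Q_map_def
  using Lambda_nonneg[OF assms] Lambda_sum[OF assms]
  by (auto intro!: convex_sum[OF _ convex_convex_hull] intro: hull_inc)

lemma Q_map_nth:
  fixes l :: "real ^ 'n::finite node ^ 'd::finite"
  assumes "m \<le> CARD('n)"
  shows "Q_map a l $ i $n m = (\<Sum>j\<in>{0..CARD('n)}. l $ i $n j * a i (min j m))"
  using assms by (simp add: Q_map_def Q_vertex_def Abs_node_inverse)

text \<open>The generators with index at most \<open>m\<close> agree in coordinates \<open>m\<close>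
  and \<open>Suc m\<close>; all others differ there by the grid gap. So tail sums can be read off
  from a point of Q.\<close>

lemma Q_map_diff:
  fixes l :: "real ^ 'n::finite node ^ 'd::finite"
  assumes "Suc m \<le> CARD('n)"
  shows "Q_map a l $ i $n (Suc m) - Q_map a l $ i $n m = (a i (Suc m) - a i m) * tail_sum l i (Suc m)"
proof -
  have "Q_map a l $ i $n (Suc m) - Q_map a l $ i $n m
    = (\<Sum>j\<in>{0..CARD('n)}. l $ i $n j * (a i (min j (Suc m)) - a i (min j m)))"
    using assms by (simp add: Q_map_nth sum_subtractf algebra_simps)
  also have "\<dots> = (\<Sum>j\<in>{0..CARD('n)}. if j \<in> {Suc m..} then (a i (Suc m) - a i m) * l $ i $n j else 0)"
    by (rule sum.cong) (auto simp: min_def le_Suc_eq)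
  also have "\<dots> = (\<Sum>j\<in>{0..CARD('n)} \<inter> {Suc m..}. (a i (Suc m) - a i m) * l $ i $n j)"
    by (rule sum.inter_restrict[symmetric]) simp
  also have "{0..CARD('n)} \<inter> {Suc m..} = {Suc m..CARD('n)}"
    by auto
  finally show ?thesis
    by (simp add: tail_sum_def sum_distrib_left)
qed

text \<open>Pulls the function of the extendability hypothesis back to \<open>g\<close> composed
  with \<open>A_map a\<close>.\<close>

lemma Q_map_last: "(\<chi> i. Q_map a l $ i $n CARD('n)) = A_map a (l :: real ^ 'n::finite node ^ 'd::finite)"
  by (auto simp: vec_eq_iff A_map_def Q_map_nth mult.commute intro!: sum.cong)

lemma Q_map_unit_lam:
  fixes q :: "'d::finite \<Rightarrow> nat"
  assumes "\<And>i. q i \<le> CARD('n::finite)"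
  shows "Q_map a (unit_lam q :: real ^ 'n node ^ 'd) $ i = Q_vertex (a i) (q i)"
proof -
  have "Q_map a (unit_lam q :: real ^ 'n node ^ 'd) $ i
    = (\<Sum>j\<in>{0..CARD('n)}. if j = q i then Q_vertex (a i) j else 0)"
    unfolding Q_map_def vec_lambda_beta by (rule sum.cong) auto
  then show ?thesis using assms by simp
qed

text \<open>The staircase functions, transported along \<^const>\<open>Q_map\<close>, are affine majorants on \<open>Q\<close> of the
  restriction to the vertices, hence of the function itself.\<close>

lemma staircase_value_ge:
  fixes a :: "'d::finite \<Rightarrow> nat \<Rightarrow> real" and l :: "real ^ 'n::finite node ^ 'd"
  assumes a: "\<And>i j. j < CARD('n) \<Longrightarrow> a i j < a i (Suc j)"
    and ext: "concave_extendable (\<lambda>s :: real ^ 'n node ^ 'd. g (\<chi> i. s $ i $n CARD('n)))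
      (Q_prod a) (vert (Q_prod a))"
    and \<omega>: "\<omega> \<in> directions (CARD('n))"
    and vertex: "\<And>q. (\<And>i. q i \<le> CARD('n)) \<Longrightarrow>
      g (grid_point a q) \<le> staircase_value g a (unit_lam q :: real ^ 'n node ^ 'd) \<omega>"
    and l: "l \<in> Lambda"
  shows "g (A_map a l) \<le> staircase_value g a l \<omega>"
proof -
  let ?p = "grid_path \<omega>" and ?Q = "Q_prod a :: (real ^ 'n node ^ 'd) set"
  let ?D = "\<lambda>t. g (grid_point a (?p (Suc t))) - g (grid_point a (?p t))"
  let ?g = "\<lambda>s :: real ^ 'n node ^ 'd. g (\<chi> i. s $ i $n CARD('n))"
  let ?d = "\<lambda>t. a (\<omega> ! t) (?p (Suc t) (\<omega> ! t)) - a (\<omega> ! t) (?p t (\<omega> ! t))"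
  \<comment> \<open>The tail sum of step \<open>t\<close> is replaced by a coordinate difference
    divided by the gap \<open>?d t\<close>, which turns the staircase function into one on Q. The
    constant is split off so that \<open>\<psi>0\<close> is linear.\<close>
  define \<psi>0 where "\<psi>0 s = (\<Sum>t<CARD('d) * CARD('n). (?D t / ?d t) *
      (s $ (\<omega> ! t) $n (?p (Suc t) (\<omega> ! t)) - s $ (\<omega> ! t) $n (?p t (\<omega> ! t))))"
    for s :: "real ^ 'n node ^ 'd"
  define \<psi> where "\<psi> s = g (grid_point a (?p 0)) + \<psi>0 s" for s
  have coord: "linear (\<lambda>s :: real ^ 'n node ^ 'd. s $ i $n j - s $ i $n j')" for i j j'
    by (rule linearI) (auto simp: algebra_simps)
  have "linear \<psi>0"
    unfolding \<psi>0_def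
    by (intro linear_compose_sum ballI linear_compose_scale_right[OF coord, unfolded real_scaleR_def])
  then have concave: "ereal_concave_on ?Q (\<lambda>s. ereal (\<psi> s))"
    by (intro ereal_concave_on_affine[where c = "g (grid_point a (?p 0))"] convex_Q_prod)
      (simp add: \<psi>_def)
  have \<psi>: "\<psi> (Q_map a m) = staircase_value g a m \<omega>" for m
  proof -
    have "(?D t / ?d t) * (Q_map a m $ (\<omega> ! t) $n (?p (Suc t) (\<omega> ! t)) - Q_map a m $ (\<omega> ! t) $n (?p t (\<omega> ! t)))
      = ?D t * tail_sum m (\<omega> ! t) (?p (Suc t) (\<omega> ! t))" if t: "t < CARD('d) * CARD('n)" for t
    proof -
      have "?p (Suc t) (\<omega> ! t) \<le> CARD('n)"
        using grid_path_directions_le[OF \<omega>] t by (metis Suc_leI)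
      then have "Suc (?p t (\<omega> ! t)) \<le> CARD('n)" by simp
      then show ?thesis
        using a[of "?p t (\<omega> ! t)" "\<omega> ! t"] by (simp add: Q_map_diff)
    qed
    then show ?thesis
      unfolding \<psi>_def \<psi>0_def staircase_value_steps by (intro arg_cong2[of _ _ _ _ "(+)"] refl sum.cong) auto
  qed
  have at_vert: "?g s \<le> \<psi> s" if s: "s \<in> vert ?Q" for s
  proof -
    obtain q where q: "\<And>i. q i \<le> CARD('n)" "\<And>i. s $ i = Q_vertex (a i) (q i)"
      using vert_Q_prod[OF s] by blast
    then have "s = Q_map a (unit_lam q)"
      by (simp add: vec_eq_iff Q_map_unit_lam)
    then show ?thesis
      using vertex[of q] q(1) by (simp add: \<psi> Q_map_last A_map_unit_lam)
  qed
  have "ereal (?g (Q_map a l)) \<le> conc_env ?Q (\<lambda>y. ereal (?g y)) (Q_map a l)"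
    using Q_map_in_Q_prod[OF l] by (intro conc_env_ge) auto
  \<comment> \<open>By extendability a concave majorant now has to be checked at the vertices
    only.\<close>
  also have "\<dots> = conc_env ?Q (\<lambda>y. if y \<in> vert ?Q then ereal (?g y) else -\<infinity>) (Q_map a l)"
    using ext Q_map_in_Q_prod[OF l, of a] by (auto simp: concave_extendable_def)
  also have "\<dots> \<le> ereal (\<psi> (Q_map a l))"
    using at_vert by (intro conc_env_le concave) auto
  finally show ?thesis
    by (simp add: \<psi> Q_map_last)
qed

text \<open>Supermodularity and extendability enter here, and in everything below up to the theorem,
  only through the inequality \<open>bound\<close>.\<close>

lemma conc_env_eq_Min_staircase:
  fixes a :: "'d::finite \<Rightarrow> nat \<Rightarrow> real" and l :: "real ^ 'n::finite node ^ 'd"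
  assumes bound: "\<And>l :: real ^ 'n node ^ 'd. \<And>\<omega>. l \<in> Lambda \<Longrightarrow> \<omega> \<in> directions (CARD('n)) \<Longrightarrow>
      g (A_map a l) \<le> staircase_value g a l \<omega>"
    and l: "l \<in> Lambda"
  shows "conc_env Lambda (\<lambda>l'. ereal (g (A_map a l'))) l =
    ereal (Min (staircase_value g a l ` directions (CARD('n))))"
proof -
  obtain \<omega> w where dec: "staircase_decomposition l \<omega> w"
    using Lambda_decomposition[OF l] by blast
  have \<omega>: "\<omega> \<in> directions (CARD('n))"
    and w: "\<And>t. t \<le> CARD('d) * CARD('n) \<Longrightarrow> 0 \<le> w t" "(\<Sum>t\<le>CARD('d) * CARD('n). w t) = 1"
    and l_eq: "l = (\<Sum>t\<le>CARD('d) * CARD('n). w t *\<^sub>R unit_lam (grid_path \<omega> t))"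
    and val: "\<And>g a. staircase_value g a l \<omega> =
      (\<Sum>t\<le>CARD('d) * CARD('n). w t * g (grid_point a (grid_path \<omega> t)))"
    using dec by (auto simp only: staircase_decomposition_def)
  let ?V = "staircase_value g a l ` directions (CARD('n))"
  have fin: "finite ?V" and ne: "?V \<noteq> {}"
    using finite_directions \<omega> by auto
  have p: "grid_path \<omega> t i \<le> CARD('n)" if "t \<le> CARD('d) * CARD('n)" for t i
    by (rule grid_path_directions_le[OF \<omega> that])
  show ?thesis
  proof (rule antisym)
    obtain \<omega>' where \<omega>': "\<omega>' \<in> directions (CARD('n))" "Min ?V = staircase_value g a l \<omega>'"
      using Min_in[OF fin ne] by auto
    show "conc_env Lambda (\<lambda>l'. ereal (g (A_map a l'))) l \<le> ereal (Min ?V)"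
      unfolding \<omega>'(2) using bound \<omega>'(1)
      by (intro conc_env_le ereal_concave_on_affine[OF convex_Lambda linear_staircase_value]) auto
    show "ereal (Min ?V) \<le> conc_env Lambda (\<lambda>l'. ereal (g (A_map a l'))) l"
    proof (rule conc_env_ge)
      fix h :: "real ^ 'n node ^ 'd \<Rightarrow> ereal"
      assume h: "ereal_concave_on Lambda h"
        "\<And>y. y \<in> Lambda \<Longrightarrow> ereal (g (A_map a y)) \<le> h y"
      have "ereal (Min ?V) \<le> ereal (staircase_value g a l \<omega>)"
        using fin \<omega> by auto
      also have "\<dots> \<le> h (\<Sum>t\<le>CARD('d) * CARD('n). w t *\<^sub>R unit_lam (grid_path \<omega> t))"
        unfolding val
      proof (rule ereal_concave_on_sum[OF h(1)])
        fix t assume "t \<in> {..CARD('d) * CARD('n)}"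
        then have t: "\<And>i. grid_path \<omega> t i \<le> CARD('n)" using p by simp
        show "(unit_lam (grid_path \<omega> t) :: real ^ 'n node ^ 'd) \<in> Lambda"
          by (rule unit_lam_in_Lambda[OF t])
        then show "ereal (g (grid_point a (grid_path \<omega> t))) \<le> h (unit_lam (grid_path \<omega> t))"
          using h(2)[of "unit_lam (grid_path \<omega> t)"] by (simp only: A_map_unit_lam[OF t])
      qed (use w in auto)
      finally show "ereal (Min ?V) \<le> h l"
        by (simp only: l_eq[symmetric])
    qed
  qed
qed

section \<open>The model as a polyhedron\<close>

definition lam :: "real ^ 'n::finite logcoord ^ 'd::finite \<Rightarrow> real ^ 'n node ^ 'd" where
  "lam w = (\<chi> i. lam_part (w $ i))"

definition log_vec :: "real ^ 'n::finite node ^ 'd::finite \<Rightarrow> ('d \<Rightarrow> nat \<Rightarrow> real) \<Rightarrow> real ^ 'n logcoord ^ 'd" where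
  "log_vec l \<delta> = (\<chi> i c. case Rep_logcoord c of Inl j \<Rightarrow> l $ i $n j | Inr k \<Rightarrow> \<delta> i k)"

lemma lam_nth: "lam w $ i = lam_part (w $ i)"
  by (simp add: lam_def)

lemma lam_part_nth:
  fixes z :: "real ^ 'n::finite logcoord"
  shows "j \<le> CARD('n) \<Longrightarrow> lam_part z $n j = z $ Abs_logcoord (Inl j)"
  by (simp add: lam_part_def Abs_node_inverse)

lemma lam_part_log_vec [simp]: "lam_part (log_vec l \<delta> $ i) = l $ i"
  by (rule node_vec_eqI) (simp add: lam_part_nth log_vec_def Abs_logcoord_inverse InlI)

lemma lam_log_vec [simp]: "lam (log_vec l \<delta>) = l"
  by (simp add: vec_eq_iff lam_nth)

lemma delta_part_log_vec [simp]:
  fixes l :: "real ^ 'n::finite node ^ 'd::finite"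
  assumes "k \<in> {1..nbits (CARD('n))}"
  shows "delta_part (log_vec l \<delta> $ i) k = \<delta> i k"
  using assms by (simp add: delta_part_def log_vec_def Abs_logcoord_inverse InrI)

lemma logcoord_vec_eqI:
  fixes w w' :: "real ^ 'n::finite logcoord ^ 'd::finite"
  assumes "lam w = lam w'"
    and "\<And>i k. k \<in> {1..nbits (CARD('n))} \<Longrightarrow> delta_part (w $ i) k = delta_part (w' $ i) k"
  shows "w = w'"
proof (subst vec_eq_iff, subst vec_eq_iff, intro allI)
  fix i and c :: "'n logcoord"
  have "c = Abs_logcoord (Rep_logcoord c)" "Rep_logcoord c \<in> {0..CARD('n)} <+> {1..nbits (CARD('n))}"
    using Rep_logcoord by (simp_all only: Rep_logcoord_inverse) blast
  then consider j where "j \<le> CARD('n)" "c = Abs_logcoord (Inl j)"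
    | k where "k \<in> {1..nbits (CARD('n))}" "c = Abs_logcoord (Inr k)"
    by (metis PlusE atLeastAtMost_iff)
  then show "w $ i $ c = w' $ i $ c"
  proof cases
    case 1
    then show ?thesis
      using assms(1) by (metis lam_nth lam_part_nth)
  next
    case 2
    then show ?thesis
      using assms(2)[of k i] by (simp add: delta_part_def)
  qed
qed

lemma log_vec_eta: "log_vec (lam w) (\<lambda>i. delta_part (w $ i)) = w"
  by (rule logcoord_vec_eqI) simp_all

lemma linear_lam: "linear lam"
  by (rule linearI) (auto simp: lam_def lam_part_def vec_eq_iff)

lemma linear_delta_part: "linear (\<lambda>w. delta_part (w $ i) k)"
  by (rule linearI) (auto simp: delta_part_def)

lemma delta_part_add [simp]: "delta_part (z + z') k = delta_part z k + delta_part z' k"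
  and delta_part_scaleR [simp]: "delta_part (c *\<^sub>R z) k = c * delta_part z k"
  by (simp_all add: delta_part_def)

lemma delta_part_sum [simp]: "delta_part (sum f T) k = (\<Sum>t\<in>T. delta_part (f t) k)"
  by (simp add: delta_part_def)

lemma inner_delta_basis:
  "w \<bullet> axis i (axis (Abs_logcoord (Inr k)) 1) = delta_part (w $ i) k"
  by (simp add: inner_axis delta_part_def)

lemma delta_basis_all:
  "(\<forall>b\<in>(delta_basis :: (real ^ 'n::finite logcoord ^ 'd::finite) set). w \<bullet> b \<in> D) \<longleftrightarrow>
    (\<forall>i. \<forall>k\<in>{1..nbits (CARD('n))}. delta_part (w $ i) k \<in> D)"
  unfolding delta_basis_def inner_delta_basis[symmetric] by blast

lemma delta_basis_subset_Basis: "delta_basis \<subseteq> Basis"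
  by (auto simp: delta_basis_def Basis_vec_def)

text \<open>The envelope condition becomes finitely many affine inequalities. The formula for the
  envelope needs \<open>lam w\<close> in \<Lambda>, which the \<open>LOG\<close> constraints supply;
  where they fail, both sides are false.\<close>

lemma log_model_iff:
  fixes a :: "'d::finite \<Rightarrow> nat \<Rightarrow> real" and \<theta> :: "real ^ 'd \<Rightarrow> real ^ 'k::finite"
    and w :: "real ^ 'n::finite logcoord ^ 'd"
  assumes bound: "\<And>k. \<And>l :: real ^ 'n node ^ 'd. \<And>\<omega>. l \<in> Lambda \<Longrightarrow> \<omega> \<in> directions (CARD('n)) \<Longrightarrow>
      \<theta> (A_map a l) $ k \<le> staircase_value (\<lambda>f. \<theta> f $ k) a l \<omega>"
  shows "((f, \<mu>), w) \<in> log_model D \<theta> a \<eta> \<longleftrightarrow>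
    (\<forall>k. \<forall>\<omega>\<in>directions (CARD('n)). \<mu> $ k \<le> staircase_value (\<lambda>f. \<theta> f $ k) a (lam w) \<omega>) \<and>
    f = A_map a (lam w) \<and> (\<forall>i. w $ i \<in> LOG D (\<eta> i))"
proof (cases "\<forall>i. w $ i \<in> LOG D (\<eta> i)")
  case True
  then have l: "lam w \<in> Lambda"
    by (simp add: Lambda_def LOG_def lam_nth)
  have "conc_env Lambda (\<lambda>l'. ereal (\<theta> (A_map a l') $ k)) (lam w) =
      ereal (Min (staircase_value (\<lambda>f. \<theta> f $ k) a (lam w) ` directions (CARD('n))))" for k
    by (rule conc_env_eq_Min_staircase[where g = "\<lambda>f. \<theta> f $ k", OF bound l])
  then show ?thesis
    using True by (auto simp: directions_nonempty log_model_def Let_def lam_def[symmetric] finite_directions)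
qed (auto simp: log_model_def Let_def)

section \<open>Solution sets of finite linear systems\<close>

lemma polyhedron_linear_le:
  fixes \<phi> :: "'a::euclidean_space \<Rightarrow> real"
  assumes "linear \<phi>"
  shows "polyhedron {x. \<phi> x \<le> c}"
proof -
  have "\<phi> x = adjoint \<phi> 1 \<bullet> x" for x
    using adjoint_works[OF assms, of x 1] by (simp add: inner_commute)
  then show ?thesis
    using polyhedron_halfspace_le[of "adjoint \<phi> 1" c] by simp
qed

lemma polyhedron_Collect_conj:
  "polyhedron {x. P x} \<Longrightarrow> polyhedron {x. Q x} \<Longrightarrow> polyhedron {x. P x \<and> Q x}"
  by (simp add: Collect_conj_eq)

lemma polyhedron_Collect_ball:
  assumes "finite I" "\<And>i. i \<in> I \<Longrightarrow> polyhedron {x. P i x}"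
  shows "polyhedron {x. \<forall>i\<in>I. P i x}"
proof -
  have "{x. \<forall>i\<in>I. P i x} = \<Inter> ((\<lambda>i. {x. P i x}) ` I)"
    by auto
  then show ?thesis
    using assms by (auto intro!: polyhedron_Inter)
qed

lemma polyhedron_log_model:
  fixes a :: "'d::finite \<Rightarrow> nat \<Rightarrow> real" and \<theta> :: "real ^ 'd \<Rightarrow> real ^ 'k::finite"
  assumes bound: "\<And>k. \<And>l :: real ^ 'n::finite node ^ 'd. \<And>\<omega>. l \<in> Lambda \<Longrightarrow> \<omega> \<in> directions (CARD('n)) \<Longrightarrow>
      \<theta> (A_map a l) $ k \<le> staircase_value (\<lambda>f. \<theta> f $ k) a l \<omega>"
  shows "polyhedron (log_model {0..1} \<theta> a \<eta> :: (_ \<times> (real ^ 'n logcoord ^ 'd)) set)"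
proof -
  let ?L = "\<lambda>i k. {0..CARD('n)} - L_set (CARD('n)) (\<eta> i) k"
  let ?R = "\<lambda>i k. {0..CARD('n)} - R_set (CARD('n)) (\<eta> i) k"
  let ?c = "\<lambda>k \<omega>. \<theta> (grid_point a (grid_path \<omega> 0)) $ k"
  let ?l = "\<lambda>x :: ((real ^ 'd) \<times> (real ^ 'k)) \<times> (real ^ 'n logcoord ^ 'd). lam (snd x)"
  let ?\<delta> = "\<lambda>x :: ((real ^ 'd) \<times> (real ^ 'k)) \<times> (real ^ 'n logcoord ^ 'd). \<lambda>i. delta_part (snd x $ i)"
  \<comment> \<open>Every condition is brought into the form linear function at most constant:
    equations become two inequalities, and the constant term of a staircase function moves to the
    right.\<close>
  have eq: "log_model {0..1} \<theta> a \<eta> = {x.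
      (\<forall>k\<in>UNIV. \<forall>\<omega>\<in>directions (CARD('n)).
        snd (fst x) $ k - (staircase_value (\<lambda>f. \<theta> f $ k) a (?l x) \<omega> - ?c k \<omega>) \<le> ?c k \<omega>) \<and>
      (\<forall>i\<in>UNIV. fst (fst x) $ i - A_map a (?l x) $ i \<le> 0 \<and> A_map a (?l x) $ i - fst (fst x) $ i \<le> 0) \<and>
      (\<forall>i\<in>UNIV. (\<forall>j\<in>UNIV. - (?l x $ i $ j) \<le> 0) \<and>
        (\<Sum>j\<in>{0..CARD('n)}. ?l x $ i $n j) \<le> 1 \<and> - (\<Sum>j\<in>{0..CARD('n)}. ?l x $ i $n j) \<le> - 1 \<and>
        (\<forall>k\<in>{1..nbits (CARD('n))}. - ?\<delta> x i k \<le> 0 \<and> ?\<delta> x i k \<le> 1 \<and>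
          (\<Sum>j\<in>?L i k. ?l x $ i $n j) - ?\<delta> x i k \<le> 0 \<and>
          ?\<delta> x i k + (\<Sum>j\<in>?R i k. ?l x $ i $n j) \<le> 1))}"
    (is "_ = ?P")
  proof (rule set_eqI)
    fix x :: "((real ^ 'd) \<times> (real ^ 'k)) \<times> (real ^ 'n logcoord ^ 'd)"
    obtain f \<mu> w where x: "x = ((f, \<mu>), w)" by (metis prod.exhaust)
    have "w $ i \<in> LOG {0..1} (\<eta> i) \<longleftrightarrow> (\<forall>j\<in>UNIV. - (lam w $ i $ j) \<le> 0) \<and>
        (\<Sum>j\<in>{0..CARD('n)}. lam w $ i $n j) \<le> 1 \<and> - (\<Sum>j\<in>{0..CARD('n)}. lam w $ i $n j) \<le> - 1 \<and>
        (\<forall>k\<in>{1..nbits (CARD('n))}. - delta_part (w $ i) k \<le> 0 \<and> delta_part (w $ i) k \<le> 1 \<and>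
          (\<Sum>j\<in>?L i k. lam w $ i $n j) - delta_part (w $ i) k \<le> 0 \<and>
          delta_part (w $ i) k + (\<Sum>j\<in>?R i k. lam w $ i $n j) \<le> 1)" for i
      by (auto simp: LOG_def prob_simplex_def lam_nth algebra_simps)
    moreover have "f = A_map a (lam w) \<longleftrightarrow>
        (\<forall>i\<in>UNIV. f $ i - A_map a (lam w) $ i \<le> 0 \<and> A_map a (lam w) $ i - f $ i \<le> 0)"
      by (auto simp: vec_eq_iff intro: antisym)
    ultimately show "x \<in> log_model {0..1} \<theta> a \<eta> \<longleftrightarrow> x \<in> ?P"
      using log_model_iff[where \<theta> = \<theta> and a = a and D = "{0..1}", OF bound, of f \<mu> w \<eta>] x by simp
  qed
  have l: "linear ?l"
    using linear_compose[OF linear_snd linear_lam] by (simp add: o_def)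
  have nth: "linear (\<lambda>x :: real ^ 'm::finite. x $ i)" for i
    by (rule linearI) simp_all
  have l_nth: "linear (\<lambda>x. ?l x $ i $ j)" for i j
    by (rule linearI) (simp_all add: linear_add[OF linear_lam] linear_cmul[OF linear_lam])
  have A: "linear (\<lambda>x. A_map a (?l x) $ i)" for i
    using linear_compose[OF linear_compose[OF l linear_A_map] nth] by (simp add: o_def)
  have \<delta>: "linear (\<lambda>x. ?\<delta> x i k)" for i k
    using linear_compose[OF linear_snd linear_delta_part] by (simp add: o_def)
  have st: "linear (\<lambda>x. staircase_value g a (?l x) \<omega> - g (grid_point a (grid_path \<omega> 0)))" for g \<omega>
    using linear_compose[OF l linear_staircase_value] by (simp add: o_def)
  have f: "linear (\<lambda>x :: ((real ^ 'd) \<times> (real ^ 'k)) \<times> (real ^ 'n logcoord ^ 'd). fst (fst x) $ i)" for i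
    by (rule linearI) simp_all
  have \<mu>: "linear (\<lambda>x :: ((real ^ 'd) \<times> (real ^ 'k)) \<times> (real ^ 'n logcoord ^ 'd). snd (fst x) $ k)" for k
    by (rule linearI) simp_all
  show ?thesis
    unfolding eq
    by (intro polyhedron_Collect_conj polyhedron_Collect_ball polyhedron_linear_le linear_compose_sub
        linear_compose_add linear_compose_neg linear_compose_sum ballI finite_directions
        finite_atLeastAtMost finite f \<mu> A \<delta> st l_nth)
qed

section \<open>Integrality of the extreme points\<close>

lemma gray_code_binary:
  assumes "gray_code n \<eta>" "1 \<le> n" "t \<le> n + 1" "k \<in> {1..nbits n}"
  shows "\<eta> t k = 0 \<or> \<eta> t k = 1"
proof -
  consider "t \<in> {1..n}" | "t = 0" | "t = n + 1"
    using assms(3) by fastforce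
  moreover have "\<eta> 0 k = \<eta> 1 k" "\<eta> (n + 1) k = \<eta> n k"
    using assms by (auto simp: gray_code_def)
  moreover have "\<eta> s k = 0 \<or> \<eta> s k = 1" if "s \<in> {1..n}" for s
    using assms(1,4) that by (auto simp: gray_code_def)
  ultimately show ?thesis
    using assms(2) by cases auto
qed

text \<open>The bit \<open>\<eta> j k\<close> alone decides for one of the two sets. Hence no node
  forces \<delta> to be 0 and 1 at once.\<close>

lemma L_R_set_cover:
  assumes "gray_code n \<eta>" "1 \<le> n" "k \<in> {1..nbits n}" "j \<le> n"
  shows "j \<in> L_set n \<eta> k \<or> j \<in> R_set n \<eta> k"
  using gray_code_binary[OF assms(1,2) _ assms(3), of j] assms(4)
  by (auto simp: L_set_def R_set_def)

text \<open>At a vertex each constraint sum is 0 or 1: a node outside \<open>L_set\<close> forces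
  the value 1, a node outside \<open>R_set\<close> forces 0.\<close>

lemma LOG_unit_lam:
  fixes p :: "'d::finite \<Rightarrow> nat"
  assumes p: "\<And>i. p i \<le> CARD('n::finite)"
    and \<delta>: "\<And>k. k \<in> {1..nbits (CARD('n))} \<Longrightarrow> \<delta> i k \<in> D \<inter> {0..1} \<and>
      (p i \<notin> L_set (CARD('n)) \<eta> k \<longrightarrow> \<delta> i k = 1) \<and> (p i \<notin> R_set (CARD('n)) \<eta> k \<longrightarrow> \<delta> i k = 0)"
  shows "(log_vec (unit_lam p) \<delta> :: real ^ 'n logcoord ^ 'd) $ i \<in> LOG D \<eta>"
proof -
  have sum: "(\<Sum>j\<in>{0..CARD('n)} - S. (unit_lam p :: real ^ 'n node ^ 'd) $ i $n j) = (if p i \<in> S then 0 else 1)"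
    for S
  proof -
    have "(\<Sum>j\<in>{0..CARD('n)} - S. (unit_lam p :: real ^ 'n node ^ 'd) $ i $n j)
        = (\<Sum>j\<in>{0..CARD('n)} - S. if j = p i then 1 else 0)"
      by (rule sum.cong) auto
    then show ?thesis using p by auto
  qed
  have "(unit_lam p :: real ^ 'n node ^ 'd) $ i \<in> prob_simplex"
    using unit_lam_in_Lambda[of p, OF p] by (auto simp: Lambda_def)
  moreover have "\<delta> i k \<in> D \<and> (if p i \<in> L_set (CARD('n)) \<eta> k then 0 else 1) \<le> \<delta> i k \<and>
      \<delta> i k \<le> 1 - (if p i \<in> R_set (CARD('n)) \<eta> k then 0 else 1)" if "k \<in> {1..nbits (CARD('n))}" for k
    using \<delta>[OF that] by auto
  ultimately show ?thesis
    by (simp add: LOG_def sum p del: One_nat_def atLeastAtMost_iff)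
qed

lemma split_fraction:
  fixes lo ro x :: real
  assumes "0 \<le> lo" "0 \<le> ro" "lo \<le> x" "x \<le> 1 - ro"
  obtains q where "0 \<le> q" "q \<le> 1" "x = lo + q * (1 - lo - ro)"
proof (cases "1 - lo - ro = 0")
  case True
  then show ?thesis using assms that[of 0] by auto
next
  case False
  then show ?thesis
    using assms that[of "(x - lo) / (1 - lo - ro)"] by (auto simp: field_simps)
qed

text \<open>The mass outside \<open>L_set\<close> must receive 1, the mass outside
  \<open>R_set\<close> must receive 0, and \<open>q\<close> is the share of the remaining mass that
  accounts for the rest of \<open>\<delta> i k\<close>. This exhibits \<open>\<delta> i k\<close> as
  a mean over the nodes.\<close>

lemma LOG_relaxed_mixture:
  fixes l :: "real ^ 'n::finite node ^ 'd::finite"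
  assumes \<eta>: "gray_code (CARD('n)) \<eta>"
    and z: "log_vec l \<delta> $ i \<in> LOG {0..1} \<eta>" and k: "k \<in> {1..nbits (CARD('n))}"
  obtains q where "0 \<le> q" "q \<le> 1"
    "\<delta> i k = (\<Sum>j\<in>{0..CARD('n)}. l $ i $n j *
       (if j \<notin> L_set (CARD('n)) \<eta> k then 1 else if j \<notin> R_set (CARD('n)) \<eta> k then 0 else q))"
proof -
  let ?N = "{0..CARD('n)}" and ?L = "L_set (CARD('n)) \<eta> k" and ?R = "R_set (CARD('n)) \<eta> k"
  let ?l = "\<lambda>j. l $ i $n j"
  have li: "l $ i \<in> prob_simplex" and b: "sum ?l (?N - ?L) \<le> \<delta> i k" "\<delta> i k \<le> 1 - sum ?l (?N - ?R)"
    using z k by (auto simp: LOG_def)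
  have nonneg: "0 \<le> ?l j" for j
    using li by (simp add: prob_simplex_def)
  have total: "sum ?l ?N = 1"
    using li by (simp add: prob_simplex_def)
  obtain q where q: "0 \<le> q" "q \<le> 1" "\<delta> i k = sum ?l (?N - ?L) + q * (1 - sum ?l (?N - ?L) - sum ?l (?N - ?R))"
    using split_fraction[OF sum_nonneg sum_nonneg b] nonneg by blast
  have restr: "sum ?l (?N - S) = (\<Sum>j\<in>?N. if j \<notin> S then ?l j else 0)" for S
    by (subst sum.inter_filter[symmetric]) (auto intro!: sum.cong)
  \<comment> \<open>Node by node the coefficient is \<open>(1 - q) + q\<close> outside
    \<open>?L\<close>, \<open>q - q\<close> outside \<open>?R\<close> and \<open>q\<close> in both
    sets; no node lies outside both.\<close>
  have "(\<Sum>j\<in>?N. ?l j * (if j \<notin> ?L then 1 else if j \<notin> ?R then 0 else q))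
    = (\<Sum>j\<in>?N. (1 - q) * (if j \<notin> ?L then ?l j else 0) + q * ?l j - q * (if j \<notin> ?R then ?l j else 0))"
    using L_R_set_cover[OF \<eta> _ k] by (intro sum.cong refl) (auto simp: algebra_simps Suc_le_eq)
  also have "\<dots> = (1 - q) * sum ?l (?N - ?L) + q * 1 - q * sum ?l (?N - ?R)"
    unfolding restr total[symmetric] by (simp only: sum.distrib sum_subtractf sum_distrib_left)
  finally show ?thesis
    using q that[of q] by (simp add: algebra_simps)
qed

text \<open>The points of the graph of \<theta> along the path average to \<open>A_map a l\<close>
  and the staircase values; all of them are shifted by the same vector to hit \<mu>. If \<mu> lies
  below the staircase values, the shift is downwards and the points stay in the hypograph.\<close>

lemma staircase_decomposition_graph:
  fixes l :: "real ^ 'n::finite node ^ 'd::finite" and \<theta> :: "real ^ 'd \<Rightarrow> real ^ 'k::finite"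
  assumes dec: "staircase_decomposition l \<omega> c"
  shows "(A_map a l, \<mu>) = (\<Sum>t\<le>CARD('d) * CARD('n). c t *\<^sub>R (grid_point a (grid_path \<omega> t),
    \<chi> k. \<mu> $ k + (\<theta> (grid_point a (grid_path \<omega> t)) $ k - staircase_value (\<lambda>f. \<theta> f $ k) a l \<omega>)))"
proof -
  let ?M = "CARD('d) * CARD('n)" and ?s = "\<lambda>k. staircase_value (\<lambda>f. \<theta> f $ k) a l \<omega>"
  have c: "(\<Sum>t\<le>?M. c t) = 1"
    and marginal: "\<And>u i. (\<Sum>t\<le>?M. c t * u (grid_path \<omega> t i)) = (\<Sum>j\<in>{0..CARD('n)}. l $ i $n j * u j)"
    and val: "\<And>g a. staircase_value g a l \<omega> = (\<Sum>t\<le>?M. c t * g (grid_point a (grid_path \<omega> t)))"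
    using dec by (auto simp only: staircase_decomposition_def)
  have "A_map a l $ i = (\<Sum>t\<le>?M. c t * a i (grid_path \<omega> t i))" for i
    by (simp add: A_map_def marginal mult.commute)
  moreover have "(\<Sum>t\<le>?M. c t * (\<mu> $ k + (\<theta> (grid_point a (grid_path \<omega> t)) $ k - ?s k))) = \<mu> $ k" for k
  proof -
    have "(\<Sum>t\<le>?M. c t * (\<mu> $ k + (\<theta> (grid_point a (grid_path \<omega> t)) $ k - ?s k)))
      = (\<Sum>t\<le>?M. c t) * (\<mu> $ k - ?s k) + (\<Sum>t\<le>?M. c t * \<theta> (grid_point a (grid_path \<omega> t)) $ k)"
      unfolding sum_distrib_right sum.distrib[symmetric] by (rule sum.cong) (auto simp: algebra_simps)
    then show ?thesis
      using val[of "\<lambda>f. \<theta> f $ k" a] c by simp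
  qed
  ultimately show ?thesis
    by (simp add: prod_eq_iff fst_sum snd_sum vec_eq_iff grid_point_def)
qed

text \<open>A comonotone decomposition of \<open>\<lambda>\<close> lifts to the model: give \<open>\<delta>\<^sub>i\<^sub>k\<close> its forced value at the
  nodes outside \<open>L\<^sub>i\<^sub>k \<inter> R\<^sub>i\<^sub>k\<close> and one common fraction on \<open>L\<^sub>i\<^sub>k \<inter> R\<^sub>i\<^sub>k\<close>. Hence an extreme point has
  unit vectors \<open>\<lambda>\<^sub>i\<close>, and then each \<open>\<delta>\<^sub>i\<^sub>k\<close> that is not forced ranges over all of \<open>[0, 1]\<close>.\<close>

lemma ideal_log_model:
  fixes a :: "'d::finite \<Rightarrow> nat \<Rightarrow> real" and \<theta> :: "real ^ 'd \<Rightarrow> real ^ 'k::finite"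
  assumes bound: "\<And>k. \<And>l :: real ^ 'n::finite node ^ 'd. \<And>\<omega>. l \<in> Lambda \<Longrightarrow> \<omega> \<in> directions (CARD('n)) \<Longrightarrow>
      \<theta> (A_map a l) $ k \<le> staircase_value (\<lambda>f. \<theta> f $ k) a l \<omega>"
    and \<eta>: "\<And>i. gray_code (CARD('n)) (\<eta> i)"
  shows "ideal_relaxation (log_model {0..1} \<theta> a \<eta>) (delta_basis :: (real ^ 'n logcoord ^ 'd) set)"
proof -
  let ?R = "log_model {0..1} \<theta> a \<eta> :: (_ \<times> (real ^ 'n logcoord ^ 'd)) set"
  let ?L = "\<lambda>i. L_set (CARD('n)) (\<eta> i)" and ?R' = "\<lambda>i. R_set (CARD('n)) (\<eta> i)"
  let ?M = "CARD('d) * CARD('n)" and ?K = "{1..nbits (CARD('n))}"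
  have model: "((f, \<mu>), w) \<in> ?R \<longleftrightarrow>
    (\<forall>k. \<forall>\<omega>\<in>directions (CARD('n)). \<mu> $ k \<le> staircase_value (\<lambda>f. \<theta> f $ k) a (lam w) \<omega>) \<and>
    f = A_map a (lam w) \<and> (\<forall>i. w $ i \<in> LOG {0..1} (\<eta> i))" for f \<mu> w
    by (rule log_model_iff) (rule bound)
  have convex: "convex ?R"
    by (intro polyhedron_imp_convex polyhedron_log_model) (rule bound)
  have "delta_part (w $ i) k \<in> {0, 1}" if x: "((f, \<mu>), w) \<in> vert ?R" and k: "k \<in> ?K" for f \<mu> w i k
  proof -
    define l where "l = lam w"
    define \<delta> where "\<delta> i = delta_part (w $ i)" for i
    have w: "w = log_vec l \<delta>"
      unfolding l_def \<delta>_def by (rule log_vec_eta[symmetric])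
    have ext: "((f, \<mu>), w) extreme_point_of ?R" and inR: "((f, \<mu>), w) \<in> ?R"
      using x by (auto simp: vert_def extreme_point_of_def)
    then have \<mu>: "\<And>k \<omega>. \<omega> \<in> directions (CARD('n)) \<Longrightarrow> \<mu> $ k \<le> staircase_value (\<lambda>f. \<theta> f $ k) a l \<omega>"
      and f: "f = A_map a l" and LOG: "\<And>i. log_vec l \<delta> $ i \<in> LOG {0..1} (\<eta> i)"
      using model[of f \<mu> w] by (auto simp: w)
    have l: "l \<in> Lambda"
      using LOG by (auto simp: Lambda_def LOG_def)
    obtain \<omega> c where dec: "staircase_decomposition l \<omega> c"
      using Lambda_decomposition[OF l] by blast
    have \<omega>: "\<omega> \<in> directions (CARD('n))"
      and c: "\<And>t. t \<le> ?M \<Longrightarrow> 0 \<le> c t" "(\<Sum>t\<le>?M. c t) = 1"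
      and l_eq: "l = (\<Sum>t\<le>?M. c t *\<^sub>R unit_lam (grid_path \<omega> t))"
      and marginal: "\<And>u i. (\<Sum>t\<le>?M. c t * u (grid_path \<omega> t i)) = (\<Sum>j\<in>{0..CARD('n)}. l $ i $n j * u j)"
      and val: "\<And>g a. staircase_value g a l \<omega> = (\<Sum>t\<le>?M. c t * g (grid_point a (grid_path \<omega> t)))"
      using dec by (auto simp only: staircase_decomposition_def)
    have p: "grid_path \<omega> t i \<le> CARD('n)" if "t \<le> ?M" for t i
      by (rule grid_path_directions_le[OF \<omega> that])
    define frac where "frac i k q \<longleftrightarrow> 0 \<le> q \<and> q \<le> 1 \<and> \<delta> i k = (\<Sum>j\<in>{0..CARD('n)}. l $ i $n j *
       (if j \<notin> ?L i k then 1 else if j \<notin> ?R' i k then 0 else q))" for i k q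
    have "\<exists>q. frac i k q" if "k \<in> ?K" for i k
      by (rule LOG_relaxed_mixture[OF \<eta> LOG that]) (auto simp only: frac_def)
    moreover define q where "q i k = (SOME q. frac i k q)" for i k
    ultimately have "frac i k (q i k)" if "k \<in> ?K" for i k
      using that by (metis someI_ex)
    then have q: "\<And>i k. k \<in> ?K \<Longrightarrow> 0 \<le> q i k" "\<And>i k. k \<in> ?K \<Longrightarrow> q i k \<le> 1"
      "\<And>i k. k \<in> ?K \<Longrightarrow> \<delta> i k = (\<Sum>j\<in>{0..CARD('n)}. l $ i $n j *
         (if j \<notin> ?L i k then 1 else if j \<notin> ?R' i k then 0 else q i k))"
      by (simp_all only: frac_def)
    \<comment> \<open>The value depends on the path point only through its coordinate
      \<open>p i\<close>, as the marginal identity requires.\<close>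
    define \<delta>' where "\<delta>' p i k = (if p i \<notin> ?L i k then 1 else if p i \<notin> ?R' i k then 0 else q i k)" for p i k
    define s where "s k = staircase_value (\<lambda>f. \<theta> f $ k) a l \<omega>" for k
    let ?U = "\<lambda>t. log_vec (unit_lam (grid_path \<omega> t) :: real ^ 'n node ^ 'd) (\<delta>' (grid_path \<omega> t))"
    define X where "X t = ((grid_point a (grid_path \<omega> t),
        \<chi> k. \<mu> $ k + (\<theta> (grid_point a (grid_path \<omega> t)) $ k - s k)),
        ?U t)" for t
    have X_in: "X t \<in> ?R" if t: "t \<le> ?M" for t
    proof -
      let ?u = "unit_lam (grid_path \<omega> t) :: real ^ 'n node ^ 'd"
      note pt = p[OF t]
      have A: "A_map a ?u = grid_point a (grid_path \<omega> t)"
        by (rule A_map_unit_lam[OF pt])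
      \<comment> \<open>The shift \<open>\<mu> $ k - s k\<close> is nonpositive, and
        \<open>bound\<close> at the vertex covers every other path \<open>\<omega>'\<close>.\<close>
      have "\<mu> $ k + (\<theta> (grid_point a (grid_path \<omega> t)) $ k - s k) \<le> staircase_value (\<lambda>f. \<theta> f $ k) a ?u \<omega>'"
        if "\<omega>' \<in> directions (CARD('n))" for k \<omega>'
        using \<mu>[OF \<omega>, of k] bound[OF unit_lam_in_Lambda[of "grid_path \<omega> t", OF pt] that, where k = k]
        unfolding A s_def by linarith
      moreover have "log_vec ?u (\<delta>' (grid_path \<omega> t)) $ i \<in> LOG {0..1} (\<eta> i)" for i
      proof (rule LOG_unit_lam[OF pt])
        fix k assume k: "k \<in> ?K"
        then show "\<delta>' (grid_path \<omega> t) i k \<in> {0..1} \<inter> {0..1} \<and>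
          (grid_path \<omega> t i \<notin> ?L i k \<longrightarrow> \<delta>' (grid_path \<omega> t) i k = 1) \<and>
          (grid_path \<omega> t i \<notin> ?R' i k \<longrightarrow> \<delta>' (grid_path \<omega> t) i k = 0)"
          using q(1,2)[of k i] L_R_set_cover[OF \<eta> _ k pt] by (auto simp: \<delta>'_def Suc_le_eq)
      qed
      ultimately show ?thesis
        unfolding X_def model by (simp add: A)
    qed
    have X_sum: "((f, \<mu>), w) = (\<Sum>t\<le>?M. c t *\<^sub>R X t)"
    proof -
      have "(f, \<mu>) = (\<Sum>t\<le>?M. c t *\<^sub>R (grid_point a (grid_path \<omega> t),
          \<chi> k. \<mu> $ k + (\<theta> (grid_point a (grid_path \<omega> t)) $ k - s k)))"
        unfolding f s_def by (rule staircase_decomposition_graph[OF dec])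
      moreover have "w = (\<Sum>t\<le>?M. c t *\<^sub>R ?U t)"
      proof (rule logcoord_vec_eqI)
        show "lam w = lam (\<Sum>t\<le>?M. c t *\<^sub>R ?U t)"
          by (simp add: linear_sum[OF linear_lam] linear_cmul[OF linear_lam] l_def[symmetric] flip: l_eq)
        fix i k assume k: "k \<in> ?K"
        have "\<delta> i k = (\<Sum>t\<le>?M. c t * \<delta>' (grid_path \<omega> t) i k)"
          unfolding q(3)[OF k] \<delta>'_def by (rule marginal[symmetric])
        then show "delta_part (w $ i) k =
          delta_part ((\<Sum>t\<le>?M. c t *\<^sub>R ?U t) $ i) k"
          using k by (simp add: \<delta>_def)
      qed
      ultimately show ?thesis
        by (simp add: X_def prod_eq_iff fst_sum snd_sum)
    qed
    have hull: "convex hull (X ` {..?M}) \<subseteq> ?R"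
      using X_in convex
      by (intro hull_minimal) auto
    have "((f, \<mu>), w) \<in> convex hull (X ` {..?M})"
      unfolding X_sum using c by (intro convex_sum[OF _ convex_convex_hull]) (auto intro: hull_inc)
    \<comment> \<open>An extreme point stays extreme in a smaller set containing it, here a hull of
      finitely many points, and must therefore be one of these.\<close>
    then have "((f, \<mu>), w) extreme_point_of convex hull (X ` {..?M})"
      using ext hull by (auto simp: extreme_point_of_def)
    then have "((f, \<mu>), w) \<in> X ` {..?M}"
      by (rule extreme_point_of_convex_hull)
    then obtain t where t: "t \<le> ?M" "w = log_vec (unit_lam (grid_path \<omega> t)) (\<delta>' (grid_path \<omega> t))"
      by (auto simp: X_def)
    let ?p = "grid_path \<omega> t"
    have l_unit: "l = unit_lam ?p"
      using t(2) by (simp add: l_def)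
    have \<delta>_eq: "\<delta> i k = \<delta>' ?p i k" if "k \<in> ?K" for i k
      using t(2) that by (simp add: \<delta>_def)
    show ?thesis
    proof (rule ccontr)
      assume "delta_part (w $ i) k \<notin> {0, 1}"
      \<comment> \<open>Forced values are 0 or 1, so a fractional entry sits at a node in both
        sets.\<close>
      then have free: "?p i \<in> ?L i k" "?p i \<in> ?R' i k" and between: "0 < \<delta> i k" "\<delta> i k < 1"
        using q(1,2)[OF k, of i] \<delta>_eq[OF k, of i] by (auto simp: \<delta>_def \<delta>'_def less_le split: if_splits)
      \<comment> \<open>At a free node the entry may be overwritten by either 0 or 1 without leaving
        the model, and the given point divides the segment between the two in the ratio given by
        \<open>\<delta> i k\<close>.\<close>
      define Y where "Y v = ((f, \<mu>), log_vec l (\<delta>(i := (\<delta> i)(k := v))))" for v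
      have Y_in: "Y v \<in> ?R" if v: "v \<in> {0, 1}" for v
      proof -
        have "log_vec (unit_lam ?p :: real ^ 'n node ^ 'd) (\<delta>(i := (\<delta> i)(k := v))) $ i' \<in> LOG {0..1} (\<eta> i')" for i'
        proof (rule LOG_unit_lam[OF p[OF t(1)]])
          fix k' assume k': "k' \<in> ?K"
          then show "(\<delta>(i := (\<delta> i)(k := v))) i' k' \<in> {0..1} \<inter> {0..1} \<and>
            (?p i' \<notin> ?L i' k' \<longrightarrow> (\<delta>(i := (\<delta> i)(k := v))) i' k' = 1) \<and>
            (?p i' \<notin> ?R' i' k' \<longrightarrow> (\<delta>(i := (\<delta> i)(k := v))) i' k' = 0)"
            using v free q(1,2)[OF k', of i'] \<delta>_eq[OF k', of i'] L_R_set_cover[OF \<eta> _ k' p[OF t(1)], of i' i']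
            by (auto simp: \<delta>'_def Suc_le_eq)
        qed
        then show ?thesis
          unfolding Y_def model using \<mu> by (simp add: l_unit[symmetric] f)
      qed
      have "w = (1 - \<delta> i k) *\<^sub>R log_vec l (\<delta>(i := (\<delta> i)(k := 0))) +
          \<delta> i k *\<^sub>R log_vec l (\<delta>(i := (\<delta> i)(k := 1)))"
      proof (rule logcoord_vec_eqI)
        show "lam w = lam ((1 - \<delta> i k) *\<^sub>R log_vec l (\<delta>(i := (\<delta> i)(k := 0))) +
          \<delta> i k *\<^sub>R log_vec l (\<delta>(i := (\<delta> i)(k := 1))))"
          by (simp add: linear_add[OF linear_lam] linear_cmul[OF linear_lam] l_def[symmetric]
              scaleR_add_left[symmetric])
        fix i' k' assume "k' \<in> ?K"
        then have "delta_part (((1 - \<delta> i k) *\<^sub>R log_vec l (\<delta>(i := (\<delta> i)(k := 0))) +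
            \<delta> i k *\<^sub>R log_vec l (\<delta>(i := (\<delta> i)(k := 1)))) $ i') k' =
          (1 - \<delta> i k) * (\<delta>(i := (\<delta> i)(k := 0))) i' k' + \<delta> i k * (\<delta>(i := (\<delta> i)(k := 1))) i' k'"
          by simp
        also have "\<dots> = delta_part (w $ i') k'"
          by (auto simp: \<delta>_def algebra_simps)
        finally show "delta_part (w $ i') k' = delta_part (((1 - \<delta> i k) *\<^sub>R log_vec l (\<delta>(i := (\<delta> i)(k := 0))) +
            \<delta> i k *\<^sub>R log_vec l (\<delta>(i := (\<delta> i)(k := 1)))) $ i') k'"
          by (rule sym)
      qed
      then have "((f, \<mu>), w) = (1 - \<delta> i k) *\<^sub>R Y 0 + \<delta> i k *\<^sub>R Y 1"
        by (simp add: Y_def scaleR_add_left[symmetric])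
      moreover have "Y 0 \<noteq> Y 1"
      proof
        assume "Y 0 = Y 1"
        then have "delta_part (log_vec l (\<delta>(i := (\<delta> i)(k := 0))) $ i) k =
            delta_part (log_vec l (\<delta>(i := (\<delta> i)(k := 1))) $ i) k"
          by (simp only: Y_def prod.inject)
        then show False using k by simp
      qed
      ultimately have "((f, \<mu>), w) \<in> open_segment (Y 0) (Y 1)"
        using between unfolding in_segment by blast
      then show False
        using ext Y_in by (auto simp: extreme_point_of_def)
    qed
  qed
  note integral = this
  show ?thesis
    unfolding ideal_relaxation_def
  proof (rule ballI)
    fix x assume x: "x \<in> vert ?R"
    obtain f \<mu> w where "x = ((f, \<mu>), w)" by (metis prod.exhaust)
    then show "case x of (x, w) \<Rightarrow> \<forall>b\<in>delta_basis. w \<bullet> b \<in> {0, 1}"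
      using integral x by (simp only: prod.case delta_basis_all) blast
  qed
qed

section \<open>Projection of the model\<close>

text \<open>Neighbouring codes differ in at most one bit, so a bitwise mixture of the two is one of
  them. The conventions for the codes 0 and n + 1 keep the resulting \<open>t\<close> in the range 1
  to n at the end nodes.\<close>

lemma gray_code_adjacent:
  assumes \<eta>: "gray_code n \<eta>" and n: "1 \<le> n" and j: "j \<le> n"
    and \<delta>: "\<And>k. k \<in> {1..nbits n} \<Longrightarrow> \<delta> k = \<eta> j k \<or> \<delta> k = \<eta> (j + 1) k"
  obtains t where "t \<in> {1..n}" "j = t - 1 \<or> j = t" "\<And>k. k \<in> {1..nbits n} \<Longrightarrow> \<delta> k = \<eta> t k"
proof -
  have ends: "\<eta> 0 k = \<eta> 1 k" "\<eta> (n + 1) k = \<eta> n k" if "k \<in> {1..nbits n}" for k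
    using \<eta> that by (auto simp: gray_code_def)
  consider "j = 0" | "j = n" | "j \<in> {1..<n}"
    using j by fastforce
  then show ?thesis
  proof cases
    case 1
    then show ?thesis
      using that[of 1] \<delta> ends n by auto
  next
    case 2
    then show ?thesis
      using that[of n] \<delta> ends n by fastforce
  next
    case 3
    let ?D = "{k \<in> {1..nbits n}. \<eta> j k \<noteq> \<eta> (j + 1) k}"
    have card: "card ?D \<le> 1"
      using \<eta> 3 by (auto simp: gray_code_def)
    show ?thesis
    proof (cases "\<forall>k\<in>{1..nbits n}. \<delta> k = \<eta> j k")
      case True
      then show ?thesis
        using that[of j] 3 by auto
    next
      case False
      \<comment> \<open>A bit at variance with code \<open>j\<close> must be the unique bit where
        codes \<open>j\<close> and \<open>j + 1\<close> differ; in all other bits the two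
        coincide.\<close>
      then obtain k0 where "k0 \<in> {1..nbits n}" "\<delta> k0 \<noteq> \<eta> j k0"
        by blast
      then have k0: "k0 \<in> ?D" "\<delta> k0 = \<eta> (j + 1) k0"
        using \<delta>[of k0] by auto
      have "\<delta> k = \<eta> (j + 1) k" if k: "k \<in> {1..nbits n}" for k
      proof (cases "k \<in> ?D")
        case True
        then have "k = k0"
          using k0(1) card card_le_Suc0_iff_eq[of ?D] by auto
        then show ?thesis using k0(2) by simp
      next
        case False
        then show ?thesis using \<delta>[OF k] k by auto
      qed
      then show ?thesis
        using that[of "j + 1"] 3 by auto
    qed
  qed
qed

text \<open>A binary \<delta> spells the complement of a code. Every node of positive weight is an
  end of a cell with that code, and since the codes are distinct, all these cells are the
  same.\<close>

lemma LOG_binary_support: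
  fixes z :: "real ^ 'n::finite logcoord"
  assumes \<eta>: "gray_code (CARD('n)) \<eta>" and z: "z \<in> LOG {0, 1} \<eta>"
  obtains t where "t \<in> {1..CARD('n)}"
    "\<And>j. j \<le> CARD('n) \<Longrightarrow> lam_part z $n j \<noteq> 0 \<Longrightarrow> j = t - 1 \<or> j = t"
proof -
  let ?n = "CARD('n)" and ?K = "{1..nbits (CARD('n))}"
  have n: "1 \<le> ?n" by (simp add: Suc_le_eq)
  \<comment> \<open>The complement is taken because the value 0 removes all mass outside
    \<open>L_set\<close>, the set of nodes next to a code bit 1.\<close>
  define \<delta> where "\<delta> k = (if delta_part z k = 0 then 1 else 0 :: nat)" for k
  have nonneg: "0 \<le> lam_part z $ j" for j
    using z by (simp add: LOG_def prob_simplex_def)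
  have zero: "lam_part z $n j = 0" if "j \<in> S" "S \<subseteq> {0..?n}" "(\<Sum>j\<in>S. lam_part z $n j) \<le> 0" for j S
    using that member_le_sum[of j S "\<lambda>j. lam_part z $n j"] nonneg finite_subset[OF that(2)]
    by (auto intro: antisym)
  have near: "\<delta> k = \<eta> j k \<or> \<delta> k = \<eta> (j + 1) k" if j: "j \<le> ?n" "lam_part z $n j \<noteq> 0" and k: "k \<in> ?K" for j k
  proof -
    have b: "delta_part z k \<in> {0, 1}" "(\<Sum>j\<in>{0..?n} - L_set ?n \<eta> k. lam_part z $n j) \<le> delta_part z k"
      "delta_part z k \<le> 1 - (\<Sum>j\<in>{0..?n} - R_set ?n \<eta> k. lam_part z $n j)"
      using z k by (auto simp: LOG_def)
    show ?thesis
    proof (cases "delta_part z k = 0")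
      case True
      then have "j \<in> L_set ?n \<eta> k"
        using zero[of j "{0..?n} - L_set ?n \<eta> k"] b j by auto
      then show ?thesis using True by (auto simp: \<delta>_def L_set_def)
    next
      case False
      then have "j \<in> R_set ?n \<eta> k"
        using zero[of j "{0..?n} - R_set ?n \<eta> k"] b j by auto
      then show ?thesis using False by (auto simp: \<delta>_def R_set_def)
    qed
  qed
  have ex: "\<exists>t. t \<in> {1..?n} \<and> (j = t - 1 \<or> j = t) \<and> (\<forall>k\<in>?K. \<delta> k = \<eta> t k)"
    if "j \<le> ?n" "lam_part z $n j \<noteq> 0" for j
    using gray_code_adjacent[OF \<eta> n that(1), of \<delta>] near[OF that] by metis
  have "(\<Sum>j\<in>{0..?n}. lam_part z $n j) = 1"
    using z by (simp add: LOG_def prob_simplex_def)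
  then obtain j0 where "j0 \<le> ?n" "lam_part z $n j0 \<noteq> 0"
    by (metis atLeastAtMost_iff sum.neutral zero_neq_one)
  then obtain t where t: "t \<in> {1..?n}" "\<And>k. k \<in> ?K \<Longrightarrow> \<delta> k = \<eta> t k"
    using ex by blast
  show ?thesis
  proof (rule that[OF t(1)])
    fix j assume "j \<le> ?n" "lam_part z $n j \<noteq> 0"
    then obtain t' where t': "t' \<in> {1..?n}" "j = t' - 1 \<or> j = t'" "\<And>k. k \<in> ?K \<Longrightarrow> \<delta> k = \<eta> t' k"
      using ex by blast
    have "t' = t"
    proof (rule ccontr)
      assume "t' \<noteq> t"
      then obtain k where "k \<in> ?K" "\<eta> t' k \<noteq> \<eta> t k"
        using \<eta> t(1) t'(1) unfolding gray_code_def by blast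
      then show False using t(2) t'(3) by metis
    qed
    then show "j = t - 1 \<or> j = t" using t'(2) by simp
  qed
qed

text \<open>A path point of positive weight has each coordinate in the support of the corresponding
  marginal, so it is a corner of the cell selected by \<delta>.\<close>

lemma log_model_binary_in_hull:
  fixes a :: "'d::finite \<Rightarrow> nat \<Rightarrow> real" and \<theta> :: "real ^ 'd \<Rightarrow> real ^ 'k::finite"
    and w :: "real ^ 'n::finite logcoord ^ 'd"
  assumes bound: "\<And>k. \<And>l :: real ^ 'n node ^ 'd. \<And>\<omega>. l \<in> Lambda \<Longrightarrow> \<omega> \<in> directions (CARD('n)) \<Longrightarrow>
      \<theta> (A_map a l) $ k \<le> staircase_value (\<lambda>f. \<theta> f $ k) a l \<omega>"
    and a: "\<And>i. mono_on {0..CARD('n)} (a i)"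
    and \<eta>: "\<And>i. gray_code (CARD('n)) (\<eta> i)"
    and x: "((f, \<mu>), w) \<in> log_model {0, 1} \<theta> a \<eta>"
  shows "\<exists>H\<in>boxes (CARD('n)) a. (f, \<mu>) \<in> convex hull hyp \<theta> H"
proof -
  let ?n = "CARD('n)" and ?M = "CARD('d) * CARD('n)"
  define l where "l = lam w"
  have "((f, \<mu>), w) \<in> log_model {0, 1} \<theta> a \<eta> \<longleftrightarrow>
    (\<forall>k. \<forall>\<omega>\<in>directions (CARD('n)). \<mu> $ k \<le> staircase_value (\<lambda>f. \<theta> f $ k) a (lam w) \<omega>) \<and>
    f = A_map a (lam w) \<and> (\<forall>i. w $ i \<in> LOG {0, 1} (\<eta> i))"
    by (rule log_model_iff) (rule bound)
  then have \<mu>: "\<And>k \<omega>. \<omega> \<in> directions ?n \<Longrightarrow> \<mu> $ k \<le> staircase_value (\<lambda>f. \<theta> f $ k) a l \<omega>"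
    and f: "f = A_map a l" and LOG: "\<And>i. w $ i \<in> LOG {0, 1} (\<eta> i)"
    using x by (auto simp: l_def)
  have l: "l \<in> Lambda"
    using LOG by (auto simp: Lambda_def LOG_def l_def lam_nth)
  have "\<exists>t. t \<in> {1..?n} \<and> (\<forall>j\<le>?n. l $ i $n j \<noteq> 0 \<longrightarrow> j = t - 1 \<or> j = t)" for i
    using LOG_binary_support[OF \<eta> LOG, of i] unfolding l_def lam_nth by metis
  then obtain t where t: "\<And>i. t i \<in> {1..?n}"
    "\<And>i j. j \<le> ?n \<Longrightarrow> l $ i $n j \<noteq> 0 \<Longrightarrow> j = t i - 1 \<or> j = t i"
    by metis
  define H where "H = {x :: real ^ 'd. \<forall>i. x $ i \<in> {a i (t i - 1)..a i (t i)}}"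
  have H: "H \<in> boxes ?n a"
    unfolding boxes_def H_def using t(1) by blast
  obtain \<omega> c where dec: "staircase_decomposition l \<omega> c"
    using Lambda_decomposition[OF l] by blast
  have \<omega>: "\<omega> \<in> directions ?n"
    and c: "\<And>s. s \<le> ?M \<Longrightarrow> 0 \<le> c s" "(\<Sum>s\<le>?M. c s) = 1"
    and marginal: "\<And>u i. (\<Sum>s\<le>?M. c s * u (grid_path \<omega> s i)) = (\<Sum>j\<in>{0..?n}. l $ i $n j * u j)"
    using dec by (auto simp only: staircase_decomposition_def)
  define X where "X s = (grid_point a (grid_path \<omega> s), \<chi> k. \<mu> $ k +
    (\<theta> (grid_point a (grid_path \<omega> s)) $ k - staircase_value (\<lambda>f. \<theta> f $ k) a l \<omega>))" for s
  have X_in: "X s \<in> hyp \<theta> H" if s: "s \<le> ?M" "c s \<noteq> 0" for s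
  proof -
    have "a i (grid_path \<omega> s i) \<in> {a i (t i - 1)..a i (t i)}" for i
    proof -
      let ?j = "grid_path \<omega> s i"
      have j: "?j \<le> ?n"
        by (rule grid_path_directions_le[OF \<omega> s(1)])
      \<comment> \<open>The trivial condition keeps the left side in the form of one summand of the
        right side.\<close>
      have "c s * (if ?j = ?j then 1 else 0) \<le> (\<Sum>s'\<le>?M. c s' * (if grid_path \<omega> s' i = ?j then 1 else 0))"
        using s(1) c(1) by (intro member_le_sum) auto
      also have "\<dots> = (\<Sum>m\<in>{0..?n}. l $ i $n m * (if m = ?j then 1 else 0))"
        by (rule marginal)
      also have "\<dots> = (\<Sum>m\<in>{0..?n}. if m = ?j then l $ i $n m else 0)"
        by (rule sum.cong) auto
      also have "\<dots> = l $ i $n ?j"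
        using j by simp
      finally have "l $ i $n ?j \<noteq> 0"
        using c(1)[OF s(1)] s(2) by auto
      then have "?j = t i - 1 \<or> ?j = t i"
        using t(2) j by blast
      moreover have "a i (t i - 1) \<le> a i (t i)"
        using t(1)[of i] by (intro mono_onD[OF a]) auto
      ultimately show ?thesis by auto
    qed
    then show ?thesis
      using \<mu>[OF \<omega>] by (auto simp: X_def hyp_def H_def grid_point_def)
  qed
  have "(f, \<mu>) = (\<Sum>s\<le>?M. c s *\<^sub>R X s)"
    unfolding f X_def by (rule staircase_decomposition_graph[OF dec])
  \<comment> \<open>Path points of weight 0 may lie outside the cell and are dropped.\<close>
  also have "\<dots> = (\<Sum>s\<in>{s. s \<le> ?M \<and> c s \<noteq> 0}. c s *\<^sub>R X s)"
    by (rule sum.mono_neutral_right) auto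
  also have "\<dots> \<in> convex hull hyp \<theta> H"
  proof (rule convex_sum[OF _ convex_convex_hull])
    have "(\<Sum>s\<in>{s. s \<le> ?M \<and> c s \<noteq> 0}. c s) = (\<Sum>s\<le>?M. c s)"
      by (rule sum.mono_neutral_left) auto
    then show "(\<Sum>s\<in>{s. s \<le> ?M \<and> c s \<noteq> 0}. c s) = 1"
      using c(2) by simp
  qed (use X_in c(1) in \<open>auto intro: hull_inc\<close>)
  finally show ?thesis
    using H by blast
qed

section \<open>Lifting the hypograph over a cell into the model\<close>

lemma segment_in_simplex:
  fixes a :: "nat \<Rightarrow> real"
  assumes t: "t \<in> {1..CARD('n::finite)}" and a: "a (t - 1) < a t" and y: "y \<in> {a (t - 1)..a t}"
  obtains v :: "real ^ 'n::finite node" where "v \<in> prob_simplex" "(\<Sum>j\<in>{0..CARD('n)}. a j * v $n j) = y"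
    "\<And>j. j \<le> CARD('n) \<Longrightarrow> j \<noteq> t - 1 \<Longrightarrow> j \<noteq> t \<Longrightarrow> v $n j = 0"
proof -
  define b where "b = (y - a (t - 1)) / (a t - a (t - 1))"
  define v :: "real ^ 'n node" where
    "v = (\<chi> j. if Rep_node j = t then b else if Rep_node j = t - 1 then 1 - b else 0)"
  have b: "0 \<le> b" "b \<le> 1"
    using a y by (auto simp: b_def)
  have y_eq: "a (t - 1) * (1 - b) + a t * b = y"
  proof -
    have "b * (a t - a (t - 1)) = y - a (t - 1)"
      using a by (simp add: b_def)
    then show ?thesis by (simp add: algebra_simps)
  qed
  have v: "v $n j = (if j = t then b else if j = t - 1 then 1 - b else 0)" if "j \<le> CARD('n)" for j
    using that by (simp add: v_def Abs_node_inverse)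
  have sum: "(\<Sum>j\<in>{0..CARD('n)}. h j * v $n j) = h (t - 1) * (1 - b) + h t * b" for h
  proof -
    have "(\<Sum>j\<in>{0..CARD('n)}. h j * v $n j) = (\<Sum>j\<in>{t - 1, t}. h j * v $n j)"
      using t by (intro sum.mono_neutral_right) (auto simp: v)
    then show ?thesis
      using t by (auto simp: v)
  qed
  show ?thesis
  proof (rule that)
    show "v \<in> prob_simplex"
      using sum[of "\<lambda>_. 1"] b by (auto simp: prob_simplex_def v_def)
    show "(\<Sum>j\<in>{0..CARD('n)}. a j * v $n j) = y"
      using sum[of a] y_eq by simp
  qed (simp add: v)
qed

lemma sum_two_nodes_le:
  fixes v :: "real ^ 'n::finite node"
  assumes "v \<in> prob_simplex" "S \<subseteq> {0..CARD('n)}" "0 \<le> c"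
    and "(\<exists>j\<in>S. v $n j \<noteq> 0) \<Longrightarrow> 1 \<le> c"
  shows "(\<Sum>j\<in>S. v $n j) \<le> c"
proof (cases "\<exists>j\<in>S. v $n j \<noteq> 0")
  case True
  have "(\<Sum>j\<in>S. v $n j) \<le> (\<Sum>j\<in>{0..CARD('n)}. v $n j)"
    using assms(1,2) by (intro sum_mono2) (auto simp: prob_simplex_def)
  then show ?thesis
    using True assms by (auto simp: prob_simplex_def)
qed (use assms in auto)

text \<open>With \<delta> fixed at the value belonging to the cell, the relaxation has a convex
  slice. It therefore suffices to lift the points of the hypograph itself, by linear interpolation
  between the two nodes in each direction.\<close>

lemma hull_subset_log_model:
  fixes a :: "'d::finite \<Rightarrow> nat \<Rightarrow> real" and \<theta> :: "real ^ 'd \<Rightarrow> real ^ 'k::finite"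
  assumes bound: "\<And>k. \<And>l :: real ^ 'n::finite node ^ 'd. \<And>\<omega>. l \<in> Lambda \<Longrightarrow> \<omega> \<in> directions (CARD('n)) \<Longrightarrow>
      \<theta> (A_map a l) $ k \<le> staircase_value (\<lambda>f. \<theta> f $ k) a l \<omega>"
    and a: "\<And>i j. j < CARD('n) \<Longrightarrow> a i j < a i (Suc j)"
    and \<eta>: "\<And>i. gray_code (CARD('n)) (\<eta> i)"
    and H: "H \<in> boxes (CARD('n)) a"
  shows "convex hull hyp \<theta> H \<subseteq>
    fst ` (log_model {0, 1} \<theta> a \<eta> :: (_ \<times> (real ^ 'n logcoord ^ 'd)) set)"
proof -
  let ?n = "CARD('n)" and ?K = "{1..nbits (CARD('n))}"
  obtain t where t: "\<And>i. t i \<in> {1..?n}" and H_eq: "H = {x. \<forall>i. x $ i \<in> {a i (t i - 1)..a i (t i)}}"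
    using H by (auto simp: boxes_def)
  have model: "((f, \<mu>), w) \<in> log_model D \<theta> a \<eta> \<longleftrightarrow>
    (\<forall>k. \<forall>\<omega>\<in>directions (CARD('n)). \<mu> $ k \<le> staircase_value (\<lambda>f. \<theta> f $ k) a (lam w) \<omega>) \<and>
    f = A_map a (lam w) \<and> (\<forall>i. w $ i \<in> LOG D (\<eta> i))" for f \<mu> D and w :: "real ^ 'n logcoord ^ 'd"
    by (rule log_model_iff) (rule bound)
  \<comment> \<open>The complement of the code of the cell, as the \<open>LOG\<close> constraints
    demand.\<close>
  define \<delta> where "\<delta> i k = 1 - real (\<eta> i (t i) k)" for i k
  have \<delta>: "\<delta> i k \<in> {0, 1}" if "k \<in> ?K" for i k
    using gray_code_binary[OF \<eta>, of "t i" k i] t[of i] that by (auto simp: \<delta>_def)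
  \<comment> \<open>Convex as a slice of a polyhedron by linear equations, and contained in the
    binary model because \<open>\<delta>\<close> is binary.\<close>
  define C :: "(((real ^ 'd) \<times> (real ^ 'k)) \<times> (real ^ 'n logcoord ^ 'd)) set"
    where "C = log_model {0..1} \<theta> a \<eta> \<inter> {x. \<forall>i. \<forall>k\<in>?K. delta_part (snd x $ i) k = \<delta> i k}"
  have "convex (log_model {0..1} \<theta> a \<eta> :: (_ \<times> (real ^ 'n logcoord ^ 'd)) set)"
    by (intro polyhedron_imp_convex polyhedron_log_model) (rule bound)
  moreover have "convex {x :: ((real ^ 'd) \<times> (real ^ 'k)) \<times> (real ^ 'n logcoord ^ 'd).
      \<forall>i. \<forall>k\<in>?K. delta_part (snd x $ i) k = \<delta> i k}"
    by (rule convexI) (simp add: distrib_right[symmetric])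
  ultimately have "convex (fst ` C)"
    unfolding C_def by (intro convex_linear_image linear_fst convex_Int)
  moreover have "C \<subseteq> log_model {0, 1} \<theta> a \<eta>"
  proof
    fix x assume x: "x \<in> C"
    obtain f \<mu> w where x_eq: "x = ((f, \<mu>), w)" by (metis prod.exhaust)
    have "w $ i \<in> LOG {0, 1} (\<eta> i)" if "w $ i \<in> LOG {0..1} (\<eta> i)" for i
      using that \<delta>[of _ i] x by (auto simp: x_eq C_def LOG_def)
    then show "x \<in> log_model {0, 1} \<theta> a \<eta>"
      using x unfolding x_eq C_def by (simp add: model)
  qed
  moreover have "hyp \<theta> H \<subseteq> fst ` C"
  proof
    fix y assume "y \<in> hyp \<theta> H"
    then obtain f \<mu> where y: "y = (f, \<mu>)" "\<And>k. \<mu> $ k \<le> \<theta> f $ k" "f \<in> H"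
      by (auto simp: hyp_def)
    have "\<exists>v :: real ^ 'n node. v \<in> prob_simplex \<and> (\<Sum>j\<in>{0..?n}. a i j * v $n j) = f $ i \<and>
        (\<forall>j\<le>?n. j \<noteq> t i - 1 \<longrightarrow> j \<noteq> t i \<longrightarrow> v $n j = 0)" for i
    proof -
      have "a i (t i - 1) < a i (t i)"
        using a[of "t i - 1" i] t[of i] by auto
      moreover have "f $ i \<in> {a i (t i - 1)..a i (t i)}"
        using y(3) by (simp add: H_eq)
      ultimately show ?thesis
        by (rule segment_in_simplex[OF t]) blast
    qed
    then obtain v :: "'d \<Rightarrow> real ^ 'n node" where v: "\<And>i. v i \<in> prob_simplex"
      "\<And>i. (\<Sum>j\<in>{0..?n}. a i j * v i $n j) = f $ i"
      "\<And>i j. j \<le> ?n \<Longrightarrow> v i $n j \<noteq> 0 \<Longrightarrow> j = t i - 1 \<or> j = t i"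
      by metis
    define l where "l = (\<chi> i. v i)"
    have l: "l \<in> Lambda" and A: "A_map a l = f"
      using v(1,2) by (auto simp: l_def Lambda_def A_map_def vec_eq_iff)
    have "log_vec l \<delta> $ i \<in> LOG {0..1} (\<eta> i)" for i
    proof -
      have "(\<Sum>j\<in>{0..?n} - L_set ?n (\<eta> i) k. v i $n j) \<le> \<delta> i k \<and>
          (\<Sum>j\<in>{0..?n} - R_set ?n (\<eta> i) k. v i $n j) \<le> 1 - \<delta> i k" if k: "k \<in> ?K" for k
      proof (intro conjI sum_two_nodes_le[OF v(1)])
        \<comment> \<open>Code \<open>t i\<close> is code \<open>j + 1\<close> at the left end
          \<open>j = t i - 1\<close> of the cell and code \<open>j\<close> at its right end.\<close>
        have near: "\<eta> i (t i) k = \<eta> i j k \<or> \<eta> i (t i) k = \<eta> i (j + 1) k" if "j \<le> ?n" "v i $n j \<noteq> 0" for j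
          using v(3)[OF that] t[of i] by auto
        have bin: "\<eta> i (t i) k = 0 \<or> \<eta> i (t i) k = 1"
          using gray_code_binary[OF \<eta>, of "t i" k i] t[of i] k by auto
        show "1 \<le> \<delta> i k" if nonzero: "\<exists>j\<in>{0..?n} - L_set ?n (\<eta> i) k. v i $n j \<noteq> 0"
        proof -
          obtain j where "j \<le> ?n" "j \<notin> L_set ?n (\<eta> i) k" "v i $n j \<noteq> 0"
            using nonzero by auto
          then show ?thesis
            using near[of j] bin by (auto simp: \<delta>_def L_set_def)
        qed
        show "1 \<le> 1 - \<delta> i k" if nonzero: "\<exists>j\<in>{0..?n} - R_set ?n (\<eta> i) k. v i $n j \<noteq> 0"
        proof -
          obtain j where "j \<le> ?n" "j \<notin> R_set ?n (\<eta> i) k" "v i $n j \<noteq> 0"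
            using nonzero by auto
          then show ?thesis
            using near[of j] bin by (auto simp: \<delta>_def R_set_def)
        qed
      qed (use \<delta>[OF k, of i] in auto)
      moreover have "\<delta> i k \<in> {0..1}" if "k \<in> ?K" for k
        using \<delta>[OF that, of i] by auto
      ultimately show ?thesis
        using v(1) by (auto simp: LOG_def l_def algebra_simps simp del: One_nat_def)
    qed
    moreover have "\<mu> $ k \<le> staircase_value (\<lambda>f. \<theta> f $ k) a l \<omega>" if "\<omega> \<in> directions ?n" for k \<omega>
      using bound[OF l that, of k] y(2)[of k] by (simp add: A)
    ultimately have "((f, \<mu>), log_vec l \<delta>) \<in> C"
      unfolding C_def by (simp add: model A)
    then show "y \<in> fst ` C"
      unfolding y(1) by (rule image_eqI[rotated]) simp
  qed
  ultimately show ?thesis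
    using hull_minimal[of "hyp \<theta> H" "fst ` C" convex] by blast
qed

lemma LOG_Int:
  "(LOG (D \<inter> D') \<eta> :: (real ^ 'n::finite logcoord) set) =
    LOG D \<eta> \<inter> {z. \<forall>k\<in>{1..nbits (CARD('n))}. delta_part z k \<in> D'}"
  unfolding LOG_def by blast

lemma log_model_Int:
  "(log_model (D \<inter> D') \<theta> a \<eta> :: (_ \<times> (real ^ 'n::finite logcoord ^ 'd::finite)) set) =
    log_model D \<theta> a \<eta> \<inter> {(x, w). \<forall>b\<in>delta_basis. w \<bullet> b \<in> D'}"
  unfolding log_model_def LOG_Int delta_basis_all Let_def by blast

theorem corollary3p1:
  fixes a :: "'d::finite \<Rightarrow> nat \<Rightarrow> real"
    and fL fU :: "real ^ 'd"
    and \<theta> :: "real ^ 'd \<Rightarrow> real ^ 'k::finite"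
    and \<eta> :: "'d \<Rightarrow> nat \<Rightarrow> nat \<Rightarrow> nat"
  assumes "\<And>i. fL $ i = a i 0"
    and "\<And>i. fU $ i = a i (CARD('n::finite))"
    and "\<And>i j. j < CARD('n) \<Longrightarrow> a i j < a i (Suc j)"
    and "\<And>i. gray_code (CARD('n)) (\<eta> i)"
    and "\<And>k. supermodular_on {fL..fU} (\<lambda>f. \<theta> f $ k)"
    and "\<And>k. concave_extendable
           (\<lambda>s :: real ^ 'n node ^ 'd. \<theta> (\<chi> i. s $ i $n CARD('n)) $ k) (Q_prod a) (vert (Q_prod a))"
  shows "ideal_MILP_formulation
           (\<Union>H \<in> boxes (CARD('n)) a. convex hull (hyp \<theta> H))
           (log_model {0, 1} \<theta> a \<eta>)
           (log_model {0..1} \<theta> a \<eta>)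
           (delta_basis :: (real ^ 'n logcoord ^ 'd) set) \<and>
         (\<forall>k. \<forall>l \<in> (Lambda :: (real ^ 'n node ^ 'd) set).
           conc_env Lambda (\<lambda>l'. ereal (\<theta> (A_map a l') $ k)) l =
           ereal (Min (staircase_value (\<lambda>f. \<theta> f $ k) a l ` directions (CARD('n)))))"
proof -
  have mono: "mono_on {0..CARD('n)} (a i)" for i
  proof (rule mono_onI)
    fix r s assume "r \<in> {0..CARD('n)}" "s \<in> {0..CARD('n)}" "r \<le> s"
    from this(3,2) show "a i r \<le> a i s"
    proof (induction s rule: dec_induct)
      case (step m)
      then show ?case using assms(3)[of m i] by simp
    qed simp
  qed
  \<comment> \<open>Supermodularity yields the inequality at the vertices of \<Lambda>,
    extendability carries it to all of \<Lambda>.\<close>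
  have bound: "\<theta> (A_map a l) $ k \<le> staircase_value (\<lambda>f. \<theta> f $ k) a l \<omega>"
    if l: "l \<in> Lambda" and \<omega>: "\<omega> \<in> directions (CARD('n))" for k \<omega> and l :: "real ^ 'n node ^ 'd"
  proof (rule staircase_value_ge[where g = "\<lambda>f. \<theta> f $ k", OF assms(3) assms(6) \<omega> _ l])
    fix q :: "'d \<Rightarrow> nat" assume "\<And>i. q i \<le> CARD('n)"
    then show "\<theta> (grid_point a q) $ k \<le>
        staircase_value (\<lambda>f. \<theta> f $ k) a (unit_lam q :: real ^ 'n node ^ 'd) \<omega>"
      by (intro staircase_value_ge_at_vertex[OF assms(5) assms(1) assms(2) mono \<omega>])
  qed
  let ?E = "log_model {0, 1} \<theta> a \<eta> :: (_ \<times> (real ^ 'n logcoord ^ 'd)) set"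
  let ?R = "log_model {0..1} \<theta> a \<eta> :: (_ \<times> (real ^ 'n logcoord ^ 'd)) set"
  have proj: "(\<Union>H \<in> boxes (CARD('n)) a. convex hull (hyp \<theta> H)) = fst ` ?E"
  proof (intro equalityI subsetI)
    fix x assume "x \<in> (\<Union>H \<in> boxes (CARD('n)) a. convex hull (hyp \<theta> H))"
    then obtain H where H: "H \<in> boxes (CARD('n)) a" "x \<in> convex hull hyp \<theta> H" by blast
    have "convex hull hyp \<theta> H \<subseteq> fst ` ?E"
      by (rule hull_subset_log_model)
        (rule bound, assumption, assumption | rule assms(3), assumption | rule assms(4) H(1))+
    then show "x \<in> fst ` ?E" using H(2) by blast
  next
    fix x assume "x \<in> fst ` ?E"
    then obtain z where z: "z \<in> ?E" "x = fst z" by (rule imageE)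
    obtain f \<mu> w where "z = ((f, \<mu>), w)" by (metis prod.exhaust)
    with z have x: "x = (f, \<mu>)" "((f, \<mu>), w) \<in> ?E" by (simp_all only: fst_conv)
    have "\<exists>H\<in>boxes (CARD('n)) a. (f, \<mu>) \<in> convex hull hyp \<theta> H"
      by (rule log_model_binary_in_hull) (rule bound, assumption, assumption | rule mono assms(4) x(2))+
    then show "x \<in> (\<Union>H \<in> boxes (CARD('n)) a. convex hull (hyp \<theta> H))"
      by (simp only: x(1) UN_iff)
  qed
  have "?E = ?R \<inter> {(x, w). \<forall>b\<in>delta_basis. w \<bullet> b \<in> {0, 1}}"
    using log_model_Int[of "{0..1}" "{0, 1}" \<theta> a \<eta>] by (simp add: Int_absorb1)
  then have "mip_formulation (\<Union>H \<in> boxes (CARD('n)) a. convex hull (hyp \<theta> H)) ?E ?R delta_basis"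
    by (simp add: mip_formulation_def proj delta_basis_subset_Basis)
  moreover have "polyhedron ?R"
    by (rule polyhedron_log_model) (rule bound)
  moreover have "ideal_relaxation ?R delta_basis"
    by (rule ideal_log_model) (rule bound, assumption, assumption | rule assms(4))+
  moreover have "conc_env Lambda (\<lambda>l'. ereal (\<theta> (A_map a l') $ k)) l =
      ereal (Min (staircase_value (\<lambda>f. \<theta> f $ k) a l ` directions (CARD('n))))"
    if "l \<in> Lambda" for k and l :: "real ^ 'n node ^ 'd"
    by (rule conc_env_eq_Min_staircase[where g = "\<lambda>f. \<theta> f $ k", OF bound that])
  ultimately show ?thesis
    unfolding ideal_MILP_formulation_def by blast
qed

end
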